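(* Let $(A,\ast,\circ)$ be an anti-pre-Poisson algebra and $r=\sum_ia_i\otimes b_i\in A\otimes A$. Let $\Delta_r,\delta_r:A\to A\otimes A$ be given by $\Delta_r(x)=-(I\otimes L_\star(x)+L_\ast(x)\otimes I)r$ and $\delta_r(x)=(L_\circ(x)\otimes I-I\otimes\mathrm{ad}(x))r$. If $r$ is a solution of the APP-YBE in $(A,\ast,\circ)$ and $r+\tau(r)$ is invariant, then $(A,\ast,\circ,\Delta_r,\delta_r)$ is an anti-pre-Poisson bialgebra.
   Context: Throughout, $k$ is a field and all vector spaces and algebras are finite-dimensional over $k$. Algebras. An anti-Zinbiel algebra $(A,\ast)$ is a vector space with a bilinear operation such that $x\ast(y\ast z)=-(x\ast y+y\ast x)\ast z=-(y\ast z+z\ast y)\ast x=z\ast(y\ast x)$ and $z\ast(x\ast y)=x\ast(z\ast y)$ for all $x,y,z$. An anti-pre-Lie algebra $(A,\circ)$ is a vector space with a bilinear operation such that, with $[x,y]=x\circ y-y\circ x$, $x\circ(y\circ z)-y\circ(x\circ z)=[y,x]\circ z$ and $[x,y]\circ z+[y,z]\circ x+[z,x]\circ y=0$. An anti-pre-Poisson algebra $(A,\ast,\circ)$ consists of an anti-Zinbiel algebra $(A,\ast)$ and an anti-pre-Lie algebra $(A,\circ)$ with $(x\circ y-y\circ x)\ast z=y\ast(x\circ z)-x\circ(y\ast z)$, $(x\ast y+y\ast x)\circ z=-x\ast(y\circ z)-y\ast(x\circ z)$, and $z\circ(x\ast y+y\ast x)+x\ast(y\circ z)+y\ast(x\circ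 z)=x\ast(z\circ y)+y\ast(z\circ x)$. Put $x\star y=x\ast y+y\ast x$. Operators. $L_\ast(x)y=x\ast y$, $R_\ast(x)y=y\ast x$ (similarly for other operations), $\mathrm{ad}(x)=L_\circ(x)-R_\circ(x)$, $L_\star=L_\ast+R_\ast$. $\tau(x\otimes y)=y\otimes x$; $I$ is the identity. Invariance. $s\in A\otimes A$ is invariant if $(I\otimes L_\star(x)+L_\ast(x)\otimes I)s=0$ and $(L_\circ(x)\otimes I-I\otimes\mathrm{ad}(x))s=0$ for all $x\in A$. APP-YBE for $r=\sum_ia_i\otimes b_i$: both $D(r)=\sum_{i,j}\big(a_i\otimes b_i\ast a_j\otimes b_j-a_i\ast a_j\otimes b_i\otimes b_j+a_i\otimes a_j\otimes b_i\star b_j\big)=0$ and $S(r)=\sum_{i,j}\big(a_i\circ a_j\otimes b_i\otimes b_j+a_i\otimes b_i\circ a_j\otimes b_j-a_i\otimes a_j\otimes[b_i,b_j]\big)=0$. Anti-pre-Poisson bialgebra $(A,\ast,\circ,\Delta,\delta)$: $(A,\ast,\circ)$ is an anti-pre-Poisson algebra; $(A,\Delta,\delta)$ is an anti-pre-Poisson coalgebra, i.e. (equivalently) the operations on $A^*$ dual to $\Delta$ and $\delta$ (so $\langle\Delta(x),\zeta\otimes\eta\rangle=\langle x,\zeta\ast\eta\rangle$, $\langle\delta(x),\zeta\otimes\eta\rangle=\langle x,\zeta\circ\eta\rangle$) make $A^*$ an anti-pre-Poisson algebra; and for all $x,y\in A$: (1) $\Delta(x\star y)=(I\otimes L_\star(x))\Delta(y)-(L_\ast(y)\otimes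 I)\Delta(x)$; (2) $(\Delta+\tau\Delta)(x\ast y)=(L_\ast(x)\otimes I)(\Delta+\tau\Delta)(y)-(I\otimes R_\ast(y))\Delta(x)$; (3) $\delta([x,y])=(I\otimes\mathrm{ad}(x)-L_\circ(x)\otimes I)\delta(y)-(I\otimes\mathrm{ad}(y)-L_\circ(y)\otimes I)\delta(x)$; (4) $(I\otimes I-\tau)\big(\delta(x\circ y)-(L_\circ(x)\otimes I)\delta(y)-(I\otimes L_\circ(x))\delta(y)+(I\otimes R_\circ(y))\delta(x)\big)=0$; (5) $\delta(x\star y)=(I\otimes L_\star(x))\delta(y)+(I\otimes L_\star(y))\delta(x)+(L_\circ(x)\otimes I)\Delta(y)+(L_\circ(y)\otimes I)\Delta(x)$; (6) $\Delta([x,y])=-(L_\circ(x)\otimes I)\Delta(y)-(I\otimes L_\star(y))\delta(x)-(L_\ast(y)\otimes I)\delta(x)+(I\otimes\mathrm{ad}(x))\Delta(y)$; (7) $(\Delta+\tau\Delta)(x\circ y)=(I\otimes I+\tau)\big((L_\circ(x)\otimes I)\Delta(y)+(I\otimes L_\circ(x))\Delta(y)+(I\otimes R_\ast(y))\delta(x)\big)$; (8) $\delta(x\ast y)-\tau\delta(x\ast y)=(I\otimes L_\ast(x))\delta(y)-\tau(L_\ast(x)\otimes I)\delta(y)-(L_\circ(x)\otimes I)\Delta(y)-\tau(I\otimes L_\circ(x))\Delta(y)-(I\otimes R_\ast(y))\delta(x)-\tau(I\otimes R_\circ(y))\Delta(x)$. *)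

theory Defs
  imports Complex_Main "HOL-Library.Function_Algebras"
begin

section \<open>Algebras on a finite-dimensional vector space\<close>

text \<open>Algebras live on a linear subspace \<open>V\<close> of a type: for \<open>A\<close> itself this is \<open>UNIV\<close>, while the dual
  \<open>A\<^sup>*\<close> is only a subset of the function type.\<close>

locale fd_vector_space = vector_space scale
  for scale :: "'k::field \<Rightarrow> 'v::ab_group_add \<Rightarrow> 'v" +
  fixes V :: "'v set"
  assumes finite_spanning_set: "\<exists>B. finite B \<and> span B = V"

definition bilinear_op_on :: "('k::field \<Rightarrow> 'v::ab_group_add \<Rightarrow> 'v) \<Rightarrow> 'v set \<Rightarrow> ('v \<Rightarrow> 'v \<Rightarrow> 'v) \<Rightarrow> bool" where
  "bilinear_op_on scale V m \<longleftrightarrow>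
     (\<forall>x\<in>V. \<forall>y\<in>V. m x y \<in> V) \<and>
     (\<forall>x\<in>V. \<forall>y\<in>V. \<forall>z\<in>V. m (x + y) z = m x z + m y z \<and> m x (y + z) = m x y + m x z) \<and>
     (\<forall>c. \<forall>x\<in>V. \<forall>y\<in>V. m (scale c x) y = scale c (m x y) \<and> m x (scale c y) = scale c (m x y))"

definition anticomm :: "('v \<Rightarrow> 'v \<Rightarrow> 'v::ab_group_add) \<Rightarrow> 'v \<Rightarrow> 'v \<Rightarrow> 'v" where
  "anticomm m x y = m x y + m y x"

definition commut :: "('v \<Rightarrow> 'v \<Rightarrow> 'v::ab_group_add) \<Rightarrow> 'v \<Rightarrow> 'v \<Rightarrow> 'v" where
  "commut m x y = m x y - m y x"

locale anti_zinbiel_algebra = fd_vector_space scale V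
  for scale :: "'k::field \<Rightarrow> 'v::ab_group_add \<Rightarrow> 'v" and V :: "'v set" +
  fixes ast :: "'v \<Rightarrow> 'v \<Rightarrow> 'v"  (infixl \<open>\<ast>\<close> 70)
  assumes bilinear_ast: "bilinear_op_on scale V ast"
    and anti_zinbiel:
      "\<lbrakk>x \<in> V; y \<in> V; z \<in> V\<rbrakk> \<Longrightarrow> x \<ast> (y \<ast> z) = - ((x \<ast> y + y \<ast> x) \<ast> z)"
      "\<lbrakk>x \<in> V; y \<in> V; z \<in> V\<rbrakk> \<Longrightarrow> - ((x \<ast> y + y \<ast> x) \<ast> z) = - ((z \<ast> y + y \<ast> z) \<ast> x)"
      "\<lbrakk>x \<in> V; y \<in> V; z \<in> V\<rbrakk> \<Longrightarrow> - ((z \<ast> y + y \<ast> z) \<ast> x) = z \<ast> (y \<ast> x)"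
      "\<lbrakk>x \<in> V; y \<in> V; z \<in> V\<rbrakk> \<Longrightarrow> z \<ast> (x \<ast> y) = x \<ast> (z \<ast> y)"

locale anti_pre_lie_algebra = fd_vector_space scale V
  for scale :: "'k::field \<Rightarrow> 'v::ab_group_add \<Rightarrow> 'v" and V :: "'v set" +
  fixes circ :: "'v \<Rightarrow> 'v \<Rightarrow> 'v"  (infixl \<open>\<odot>\<close> 70)
  assumes bilinear_circ: "bilinear_op_on scale V circ"
    and anti_pre_lie:
      "\<lbrakk>x \<in> V; y \<in> V; z \<in> V\<rbrakk> \<Longrightarrow> x \<odot> (y \<odot> z) - y \<odot> (x \<odot> z) = commut circ y x \<odot> z"
      "\<lbrakk>x \<in> V; y \<in> V; z \<in> V\<rbrakk> \<Longrightarrow>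
         commut circ x y \<odot> z + commut circ y z \<odot> x + commut circ z x \<odot> y = 0"

locale anti_pre_poisson_algebra =
  anti_zinbiel_algebra scale V ast + anti_pre_lie_algebra scale V circ
  for scale :: "'k::field \<Rightarrow> 'v::ab_group_add \<Rightarrow> 'v" and V :: "'v set"
    and ast :: "'v \<Rightarrow> 'v \<Rightarrow> 'v"  (infixl \<open>\<ast>\<close> 70)
    and circ :: "'v \<Rightarrow> 'v \<Rightarrow> 'v"  (infixl \<open>\<odot>\<close> 70) +
  assumes anti_pre_poisson:
      "\<lbrakk>x \<in> V; y \<in> V; z \<in> V\<rbrakk> \<Longrightarrow> (x \<odot> y - y \<odot> x) \<ast> z = y \<ast> (x \<odot> z) - x \<odot> (y \<ast> z)"
      "\<lbrakk>x \<in> V; y \<in> V; z \<in> V\<rbrakk> \<Longrightarrow> (x \<ast> y + y \<ast> x) \<odot> z = - (x \<ast> (y \<odot> z)) - y \<ast> (x \<odot> z)"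
      "\<lbrakk>x \<in> V; y \<in> V; z \<in> V\<rbrakk> \<Longrightarrow>
         z \<odot> (x \<ast> y + y \<ast> x) + x \<ast> (y \<odot> z) + y \<ast> (x \<odot> z) = x \<ast> (z \<odot> y) + y \<ast> (z \<odot> x)"

definition Lop :: "('v \<Rightarrow> 'v \<Rightarrow> 'v) \<Rightarrow> 'v \<Rightarrow> 'v \<Rightarrow> 'v" where
  "Lop m x = (\<lambda>y. m x y)"

definition Rop :: "('v \<Rightarrow> 'v \<Rightarrow> 'v) \<Rightarrow> 'v \<Rightarrow> 'v \<Rightarrow> 'v" where
  "Rop m x = (\<lambda>y. m y x)"

definition ad :: "('v \<Rightarrow> 'v \<Rightarrow> 'v::ab_group_add) \<Rightarrow> 'v \<Rightarrow> 'v \<Rightarrow> 'v" where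
  "ad circ x = Lop circ x - Rop circ x"

definition Lstar :: "('v \<Rightarrow> 'v \<Rightarrow> 'v::ab_group_add) \<Rightarrow> 'v \<Rightarrow> 'v \<Rightarrow> 'v" where
  "Lstar ast x = Lop ast x + Rop ast x"


section \<open>The dual space and tensor products\<close>

definition dual_space :: "('k::field \<Rightarrow> 'v::ab_group_add \<Rightarrow> 'v) \<Rightarrow> ('v \<Rightarrow> 'k) set" where
  "dual_space scale = {\<zeta>. Vector_Spaces.linear scale (*) \<zeta>}"

definition dual_scale :: "'k::field \<Rightarrow> ('v \<Rightarrow> 'k) \<Rightarrow> 'v \<Rightarrow> 'k" where
  "dual_scale c \<zeta> = (\<lambda>x. c * \<zeta> x)"

text \<open>A tensor is represented by its pairing with the dual: \<open>t \<in> A \<otimes> A\<close> is the bilinear form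
  \<open>(\<zeta>, \<eta>) \<mapsto> \<langle>t, \<zeta> \<otimes> \<eta>\<rangle>\<close> on \<open>A\<^sup>*\<close>, extended by \<open>0\<close> to non-linear arguments so that equality of
  tensors is equality in HOL, and similarly for \<open>A \<otimes> A \<otimes> A\<close>. As \<open>A\<close> is finite-dimensional this
  is the tensor product; see the lemmas \<open>tensor_space_eq_sum\<close>, \<open>tensor_universal\<close> and
  \<open>tensor3_universal\<close> below. Sums and differences of tensors are pointwise.\<close>

type_synonym ('k, 'v) tensor2 = "('v \<Rightarrow> 'k) \<Rightarrow> ('v \<Rightarrow> 'k) \<Rightarrow> 'k"
type_synonym ('k, 'v) tensor3 = "('v \<Rightarrow> 'k) \<Rightarrow> ('v \<Rightarrow> 'k) \<Rightarrow> ('v \<Rightarrow> 'k) \<Rightarrow> 'k"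

definition tensor :: "('k::field \<Rightarrow> 'v::ab_group_add \<Rightarrow> 'v) \<Rightarrow> 'v \<Rightarrow> 'v \<Rightarrow> ('k, 'v) tensor2" where
  "tensor scale a b = (\<lambda>\<zeta> \<eta>. if \<zeta> \<in> dual_space scale \<and> \<eta> \<in> dual_space scale then \<zeta> a * \<eta> b else 0)"

definition tensor3 :: "('k::field \<Rightarrow> 'v::ab_group_add \<Rightarrow> 'v) \<Rightarrow> 'v \<Rightarrow> 'v \<Rightarrow> 'v \<Rightarrow> ('k, 'v) tensor3" where
  "tensor3 scale a b c = (\<lambda>\<zeta> \<eta> \<theta>.
     if \<zeta> \<in> dual_space scale \<and> \<eta> \<in> dual_space scale \<and> \<theta> \<in> dual_space scale
     then \<zeta> a * \<eta> b * \<theta> c else 0)"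

definition tensor_space :: "('k::field \<Rightarrow> 'v::ab_group_add \<Rightarrow> 'v) \<Rightarrow> ('k, 'v) tensor2 set" where
  "tensor_space scale = {t.
     (\<forall>\<zeta> \<eta>. \<zeta> \<notin> dual_space scale \<or> \<eta> \<notin> dual_space scale \<longrightarrow> t \<zeta> \<eta> = 0) \<and>
     (\<forall>\<zeta>\<in>dual_space scale. \<forall>\<zeta>'\<in>dual_space scale. \<forall>\<eta>\<in>dual_space scale.
        t (\<zeta> + \<zeta>') \<eta> = t \<zeta> \<eta> + t \<zeta>' \<eta> \<and> t \<eta> (\<zeta> + \<zeta>') = t \<eta> \<zeta> + t \<eta> \<zeta>') \<and>
     (\<forall>c. \<forall>\<zeta>\<in>dual_space scale. \<forall>\<eta>\<in>dual_space scale.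
        t (dual_scale c \<zeta>) \<eta> = c * t \<zeta> \<eta> \<and> t \<zeta> (dual_scale c \<eta>) = c * t \<zeta> \<eta>)}"

definition tensor_scale :: "'k::field \<Rightarrow> ('k, 'v) tensor2 \<Rightarrow> ('k, 'v) tensor2" where
  "tensor_scale c t = (\<lambda>\<zeta> \<eta>. c * t \<zeta> \<eta>)"

text \<open>The map \<open>f \<otimes> g\<close>, obtained by transposing \<open>f\<close> and \<open>g\<close>; see \<open>tensor_map_tensor\<close>.\<close>

definition tensor_map ::
  "('k::field \<Rightarrow> 'v::ab_group_add \<Rightarrow> 'v) \<Rightarrow> ('v \<Rightarrow> 'v) \<Rightarrow> ('v \<Rightarrow> 'v) \<Rightarrow> ('k, 'v) tensor2 \<Rightarrow> ('k, 'v) tensor2" where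
  "tensor_map scale f g t = (\<lambda>\<zeta> \<eta>.
     if \<zeta> \<in> dual_space scale \<and> \<eta> \<in> dual_space scale then t (\<zeta> \<circ> f) (\<eta> \<circ> g) else 0)"

definition flip :: "('k, 'v) tensor2 \<Rightarrow> ('k, 'v) tensor2"  (\<open>\<tau>\<close>) where
  "\<tau> t = (\<lambda>\<zeta> \<eta>. t \<eta> \<zeta>)"

lemma vector_space_dual_scale: "vector_space (dual_scale :: 'k::field \<Rightarrow> ('v \<Rightarrow> 'k) \<Rightarrow> _)"
  by unfold_locales (auto simp: dual_scale_def fun_eq_iff algebra_simps)

lemma vector_space_tensor_scale: "vector_space (tensor_scale :: 'k::field \<Rightarrow> ('k, 'v) tensor2 \<Rightarrow> _)"
  by unfold_locales (auto simp: tensor_scale_def fun_eq_iff algebra_simps)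

lemma sum_fun_apply: "(\<Sum>i\<in>I. F i) x = (\<Sum>i\<in>I. F i x)"
  by (induction I rule: infinite_finite_induct) auto

lemma dual_space_module_hom: "\<zeta> \<in> dual_space scale \<Longrightarrow> module_hom scale (*) \<zeta>"
  unfolding dual_space_def by (simp add: Vector_Spaces.linear_def)

lemmas dual_space_add = module_hom.add [OF dual_space_module_hom]
  and dual_space_scale = module_hom.scale [OF dual_space_module_hom]
  and dual_space_sum = module_hom.sum [OF dual_space_module_hom]

lemma dual_scale_apply: "dual_scale c \<zeta> x = c * \<zeta> x"
  by (simp add: dual_scale_def)

lemma flip_tensor: "\<tau> (tensor scale a b) = tensor scale b a"
  by (auto simp: flip_def tensor_def fun_eq_iff)

context vector_space
begin

lemma tensor_map_tensor:
  assumes "Vector_Spaces.linear scale scale f" "Vector_Spaces.linear scale scale g"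
  shows "tensor_map scale f g (tensor scale a b) = tensor scale (f a) (g b)"
proof -
  have "\<zeta> \<circ> h \<in> dual_space scale"
    if "\<zeta> \<in> dual_space scale" "Vector_Spaces.linear scale scale h" for \<zeta> h
    using that unfolding dual_space_def by (auto intro: Vector_Spaces.linear_compose)
  then show ?thesis
    using assms by (auto simp: tensor_map_def tensor_def fun_eq_iff)
qed

lemma obtain_dual_basis:
  assumes "fd_vector_space scale UNIV"
  obtains B e where "finite B" "\<And>b. b \<in> B \<Longrightarrow> e b \<in> dual_space scale"
    "\<And>v. v = (\<Sum>b\<in>B. scale (e b v) b)"
proof -
  obtain C where C: "finite C" "span C = UNIV"
    using fd_vector_space.finite_spanning_set[OF assms] by blast
  obtain B where B: "B \<subseteq> C" "independent B" "C \<subseteq> span B"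
    using maximal_independent_subset[of C] by blast
  have fin: "finite B" using B C finite_subset by blast
  have sp: "span B = UNIV"
    using span_mono[OF B(3)] C by (auto simp: span_span)
  show thesis
  proof (rule that[of B "\<lambda>b v. representation B v b"])
    show "v = (\<Sum>b\<in>B. scale (representation B v b) b)" for v
      using sum_representation_eq[of B v B] B fin sp by auto
    show "(\<lambda>v. representation B v b) \<in> dual_space scale" for b
      using linear_representation[OF B(2) sp] by (auto simp: dual_space_def)
  qed (rule fin)
qed

lemma dual_space_expand:
  assumes "\<zeta> \<in> dual_space scale" "\<And>v. v = (\<Sum>b\<in>B. scale (e b v) b)"
  shows "\<zeta> = (\<Sum>b\<in>B. dual_scale (\<zeta> b) (e b))"
proof
  fix v
  have "\<zeta> v = \<zeta> (\<Sum>b\<in>B. scale (e b v) b)" using assms(2)[of v] by simp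
  also have "\<dots> = (\<Sum>b\<in>B. e b v * \<zeta> b)"
    by (simp add: dual_space_sum[OF assms(1)] dual_space_scale[OF assms(1)])
  finally show "\<zeta> v = (\<Sum>b\<in>B. dual_scale (\<zeta> b) (e b)) v"
    by (simp add: sum_fun_apply dual_scale_apply mult.commute)
qed

lemma dual_space_subspace:
  shows dual_space_zero: "0 \<in> dual_space scale"
    and dual_space_plus: "\<lbrakk>\<zeta> \<in> dual_space scale; \<eta> \<in> dual_space scale\<rbrakk> \<Longrightarrow> \<zeta> + \<eta> \<in> dual_space scale"
    and dual_space_dual_scale: "\<zeta> \<in> dual_space scale \<Longrightarrow> dual_scale c \<zeta> \<in> dual_space scale"
proof -
  interpret F: vector_space_pair scale "(*) :: 'a \<Rightarrow> 'a \<Rightarrow> 'a"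
    by unfold_locales (auto simp: algebra_simps)
  show "0 \<in> dual_space scale"
    using F.linear_zero by (simp add: dual_space_def zero_fun_def)
  show "\<lbrakk>\<zeta> \<in> dual_space scale; \<eta> \<in> dual_space scale\<rbrakk> \<Longrightarrow> \<zeta> + \<eta> \<in> dual_space scale"
    using F.linear_compose_add unfolding dual_space_def by (auto simp: plus_fun_def)
  show "\<zeta> \<in> dual_space scale \<Longrightarrow> dual_scale c \<zeta> \<in> dual_space scale"
    using F.linear_compose_scale_right unfolding dual_space_def by (auto simp: dual_scale_def)
qed

lemma tensor_in_tensor_space: "tensor scale a b \<in> tensor_space scale"
  unfolding tensor_space_def mem_Collect_eq
  by (intro conjI ballI allI impI)
    (auto simp: tensor_def dual_space_plus dual_space_dual_scale dual_scale_apply distrib_left distrib_right)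

lemma tensor_space_sum:
  assumes t: "t \<in> tensor_space scale" and "finite B" and e: "\<And>b. b \<in> B \<Longrightarrow> e b \<in> dual_space scale"
    and \<eta>: "\<eta> \<in> dual_space scale"
  shows "(\<Sum>b\<in>B. dual_scale (c b) (e b)) \<in> dual_space scale \<and>
    t (\<Sum>b\<in>B. dual_scale (c b) (e b)) \<eta> = (\<Sum>b\<in>B. c b * t (e b) \<eta>) \<and>
    t \<eta> (\<Sum>b\<in>B. dual_scale (c b) (e b)) = (\<Sum>b\<in>B. c b * t \<eta> (e b))"
  using \<open>finite B\<close> e
proof (induction B)
  case empty
  have z: "dual_scale 0 0 = (0 :: 'b \<Rightarrow> 'a)"
    by (rule ext) (simp add: dual_scale_apply)
  have "t (dual_scale 0 0) \<eta> = 0 * t 0 \<eta>" "t \<eta> (dual_scale 0 0) = 0 * t \<eta> 0"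
    using t \<eta> dual_space_zero unfolding tensor_space_def by blast+
  then have "t 0 \<eta> = 0" "t \<eta> 0 = 0" unfolding z by auto
  then show ?case unfolding sum.empty using dual_space_zero by blast
next
  case (insert b B)
  let ?s = "\<Sum>b\<in>B. dual_scale (c b) (e b)"
  have IH: "?s \<in> dual_space scale \<and> t ?s \<eta> = (\<Sum>b\<in>B. c b * t (e b) \<eta>) \<and>
      t \<eta> ?s = (\<Sum>b\<in>B. c b * t \<eta> (e b))"
    by (rule insert.IH) (simp add: insert.prems)
  have s: "?s \<in> dual_space scale" and eb: "dual_scale (c b) (e b) \<in> dual_space scale"
    using insert by (auto intro: dual_space_dual_scale)
  have "t (dual_scale (c b) (e b) + ?s) \<eta> = c b * t (e b) \<eta> + t ?s \<eta>"
    "t \<eta> (dual_scale (c b) (e b) + ?s) = c b * t \<eta> (e b) + t \<eta> ?s"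
    using t s eb \<eta> insert.prems[of b] unfolding tensor_space_def by simp_all
  moreover have "dual_scale (c b) (e b) + ?s \<in> dual_space scale"
    by (rule dual_space_plus[OF eb s])
  ultimately show ?case
    unfolding sum.insert[OF insert.hyps] using IH by (simp only: simp_thms)
qed

text \<open>Every tensor is a finite sum of pure tensors.\<close>

lemma tensor_space_eq_sum:
  assumes "fd_vector_space scale UNIV" and t: "t \<in> tensor_space scale"
  shows "\<exists>(n::nat) a b. t = (\<Sum>i<n. tensor scale (a i) (b i))"
proof -
  obtain B e where B: "finite B" "\<And>b. b \<in> B \<Longrightarrow> e b \<in> dual_space scale"
    "\<And>v. v = (\<Sum>b\<in>B. scale (e b v) b)"
    using obtain_dual_basis[OF assms(1)] by metis
  have expand: "t = (\<Sum>p\<in>B\<times>B. tensor scale (scale (t (e (fst p)) (e (snd p))) (fst p)) (snd p))"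
  proof (intro ext)
    fix \<zeta> \<eta>
    show "t \<zeta> \<eta> = (\<Sum>p\<in>B\<times>B. tensor scale (scale (t (e (fst p)) (e (snd p))) (fst p)) (snd p)) \<zeta> \<eta>"
    proof (cases "\<zeta> \<in> dual_space scale \<and> \<eta> \<in> dual_space scale")
      case True
      then have z: "\<zeta> \<in> dual_space scale" and h: "\<eta> \<in> dual_space scale" by auto
      have "t \<zeta> \<eta> = t (\<Sum>b\<in>B. dual_scale (\<zeta> b) (e b)) \<eta>"
        using dual_space_expand[OF z B(3)] by simp
      also have "\<dots> = (\<Sum>b\<in>B. \<zeta> b * t (e b) \<eta>)"
        using tensor_space_sum[OF t B(1) B(2) h] by simp
      also have "\<dots> = (\<Sum>b\<in>B. \<zeta> b * t (e b) (\<Sum>c\<in>B. dual_scale (\<eta> c) (e c)))"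
        using dual_space_expand[OF h B(3)] by simp
      also have "\<dots> = (\<Sum>b\<in>B. \<zeta> b * (\<Sum>c\<in>B. \<eta> c * t (e b) (e c)))"
        using tensor_space_sum[OF t B(1) B(2) B(2)] by (intro sum.cong refl) simp
      also have "\<dots> = (\<Sum>p\<in>B\<times>B. t (e (fst p)) (e (snd p)) * \<zeta> (fst p) * \<eta> (snd p))"
        by (simp add: sum.cartesian_product' sum_distrib_left mult_ac)
      finally show ?thesis
        using z h by (simp add: sum_fun_apply tensor_def dual_space_scale)
    next
      case False
      then show ?thesis using t by (auto simp: sum_fun_apply tensor_def tensor_space_def)
    qed
  qed
  obtain f :: "nat \<Rightarrow> 'b \<times> 'b" and n where "bij_betw f {..<n} (B \<times> B)"
    using ex_bij_betw_nat_finite[of "B \<times> B"] B(1) by (auto simp: atLeast0LessThan)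
  note reindex = sum.reindex_bij_betw[OF this, symmetric]
  define x y where "x i = scale (t (e (fst (f i))) (e (snd (f i)))) (fst (f i))" and "y i = snd (f i)" for i
  have "t = (\<Sum>i<n. tensor scale (x i) (y i))"
    unfolding x_def y_def by (rule trans[OF expand reindex])
  then show ?thesis
    by (intro exI[of _ n] exI[of _ x] exI[of _ y])
qed

text \<open>Bilinear and trilinear maps factor linearly through \<^term>\<open>tensor\<close> and \<^term>\<open>tensor3\<close>.\<close>

lemma tensor_universal:
  assumes "fd_vector_space scale UNIV"
    and left: "\<And>w. Vector_Spaces.linear scale scaleW (\<lambda>v. \<beta> v w)"
    and right: "\<And>v. Vector_Spaces.linear scale scaleW (\<lambda>w. \<beta> v w)"
  shows "\<exists>\<phi>. Vector_Spaces.linear tensor_scale scaleW \<phi> \<and> (\<forall>v w. \<phi> (tensor scale v w) = \<beta> v w)"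
proof -
  obtain B e where B: "finite B" "\<And>b. b \<in> B \<Longrightarrow> e b \<in> dual_space scale"
    "\<And>v. v = (\<Sum>b\<in>B. scale (e b v) b)"
    using obtain_dual_basis[OF assms(1)] by metis
  interpret W: vector_space scaleW using left unfolding Vector_Spaces.linear_def by blast
  have lin: "f (\<Sum>b\<in>B. scale (k b) b) = (\<Sum>b\<in>B. scaleW (k b) (f b))"
    if "Vector_Spaces.linear scale scaleW f" for f k
  proof -
    interpret f: Vector_Spaces.linear scale scaleW f by fact
    show ?thesis by (simp add: f.sum f.scale)
  qed
  have left_sum: "\<beta> (\<Sum>b\<in>B. scale (k b) b) w = (\<Sum>b\<in>B. scaleW (k b) (\<beta> b w))" for k w
    by (rule lin[OF left])
  have right_sum: "\<beta> w (\<Sum>b\<in>B. scale (k b) b) = (\<Sum>b\<in>B. scaleW (k b) (\<beta> w b))" for k w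
    by (rule lin[OF right])
  define \<phi> where "\<phi> t = (\<Sum>b\<in>B. \<Sum>c\<in>B. scaleW (t (e b) (e c)) (\<beta> b c))" for t
  have "\<phi> (tensor scale v w) = \<beta> v w" for v w
  proof -
    have "\<beta> v w = \<beta> (\<Sum>b\<in>B. scale (e b v) b) (\<Sum>c\<in>B. scale (e c w) c)"
      using B(3)[of v] B(3)[of w] by simp
    also have "\<dots> = (\<Sum>b\<in>B. \<Sum>c\<in>B. scaleW (e b v * e c w) (\<beta> b c))"
      by (simp only: left_sum, simp only: right_sum W.scale_sum_right W.scale_scale)
    finally show ?thesis
      unfolding \<phi>_def by (simp add: tensor_def B(2) cong: sum.cong)
  qed
  moreover have "Vector_Spaces.linear tensor_scale scaleW \<phi>"
  proof -
    interpret T: vector_space "tensor_scale :: 'a \<Rightarrow> ('a, 'b) tensor2 \<Rightarrow> _"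
      by (rule vector_space_tensor_scale)
    show ?thesis
      by unfold_locales
        (simp_all add: \<phi>_def tensor_scale_def W.scale_left_distrib sum.distrib W.scale_sum_right)
  qed
  ultimately show ?thesis by blast
qed

lemma tensor3_universal:
  assumes "fd_vector_space scale UNIV" and "vector_space scaleW"
    and "\<And>v w. Vector_Spaces.linear scale scaleW (\<lambda>u. \<beta> u v w)"
    and "\<And>u w. Vector_Spaces.linear scale scaleW (\<lambda>v. \<beta> u v w)"
    and "\<And>u v. Vector_Spaces.linear scale scaleW (\<lambda>w. \<beta> u v w)"
  shows "\<exists>\<phi>. (\<forall>s t. \<phi> (s + t) = \<phi> s + \<phi> t) \<and>
    (\<forall>c t. \<phi> (\<lambda>\<zeta> \<eta> \<theta>. c * t \<zeta> \<eta> \<theta>) = scaleW c (\<phi> t)) \<and>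
    (\<forall>u v w. \<phi> (tensor3 scale u v w) = \<beta> u v w)"
proof -
  obtain B e where B: "finite B" "\<And>b. b \<in> B \<Longrightarrow> e b \<in> dual_space scale"
    "\<And>v. v = (\<Sum>b\<in>B. scale (e b v) b)"
    using obtain_dual_basis[OF assms(1)] by metis
  interpret W: vector_space scaleW by fact
  have lin: "f (\<Sum>b\<in>B. scale (k b) b) = (\<Sum>b\<in>B. scaleW (k b) (f b))"
    if "Vector_Spaces.linear scale scaleW f" for f k
  proof -
    interpret f: Vector_Spaces.linear scale scaleW f by fact
    show ?thesis by (simp add: f.sum f.scale)
  qed
  define \<phi> where "\<phi> t = (\<Sum>a\<in>B. \<Sum>b\<in>B. \<Sum>c\<in>B. scaleW (t (e a) (e b) (e c)) (\<beta> a b c))" for t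
  have "\<phi> (tensor3 scale u v w) = \<beta> u v w" for u v w
  proof -
    have "\<beta> u v w = \<beta> (\<Sum>b\<in>B. scale (e b u) b) (\<Sum>b\<in>B. scale (e b v) b) (\<Sum>c\<in>B. scale (e c w) c)"
      using B(3)[of u] B(3)[of v] B(3)[of w] by simp
    also have "\<dots> = (\<Sum>a\<in>B. \<Sum>b\<in>B. \<Sum>c\<in>B. scaleW (e a u * e b v * e c w) (\<beta> a b c))"
      by (simp only: lin[OF assms(3)], simp only: lin[OF assms(4)],
          simp only: lin[OF assms(5)] W.scale_sum_right W.scale_scale mult.assoc)
    finally show ?thesis
      unfolding \<phi>_def by (simp add: tensor3_def B(2) cong: sum.cong)
  qed
  moreover have "\<phi> (s + t) = \<phi> s + \<phi> t" for s t
    by (simp add: \<phi>_def W.scale_left_distrib sum.distrib)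
  moreover have "\<phi> (\<lambda>\<zeta> \<eta> \<theta>. c * t \<zeta> \<eta> \<theta>) = scaleW c (\<phi> t)" for c t
    by (simp add: \<phi>_def W.scale_sum_right)
  ultimately show ?thesis by blast
qed

end


section \<open>Anti-pre-Poisson bialgebras\<close>

text \<open>The operation on \<open>A\<^sup>*\<close> dual to \<open>\<Delta>\<close>: \<open>\<langle>x, \<zeta> \<cdot> \<eta>\<rangle> = \<langle>\<Delta> x, \<zeta> \<otimes> \<eta>\<rangle>\<close>.\<close>

definition dual_op :: "('v \<Rightarrow> ('k, 'v) tensor2) \<Rightarrow> ('v \<Rightarrow> 'k) \<Rightarrow> ('v \<Rightarrow> 'k) \<Rightarrow> 'v \<Rightarrow> 'k" where
  "dual_op \<Delta> \<zeta> \<eta> = (\<lambda>x. \<Delta> x \<zeta> \<eta>)"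

locale anti_pre_poisson_coalgebra = fd_vector_space scale UNIV
  for scale :: "'k::field \<Rightarrow> 'v::ab_group_add \<Rightarrow> 'v" +
  fixes \<Delta> \<delta> :: "'v \<Rightarrow> ('k, 'v) tensor2"
  assumes comult_ast: "Vector_Spaces.linear scale tensor_scale \<Delta>" "range \<Delta> \<subseteq> tensor_space scale"
    and comult_circ: "Vector_Spaces.linear scale tensor_scale \<delta>" "range \<delta> \<subseteq> tensor_space scale"
    and dual_algebra:
      "anti_pre_poisson_algebra dual_scale (dual_space scale) (dual_op \<Delta>) (dual_op \<delta>)"

locale anti_pre_poisson_bialgebra =
  anti_pre_poisson_algebra scale UNIV ast circ + anti_pre_poisson_coalgebra scale \<Delta> \<delta>
  for scale :: "'k::field \<Rightarrow> 'v::ab_group_add \<Rightarrow> 'v"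
    and ast :: "'v \<Rightarrow> 'v \<Rightarrow> 'v"  (infixl \<open>\<ast>\<close> 70)
    and circ :: "'v \<Rightarrow> 'v \<Rightarrow> 'v"  (infixl \<open>\<odot>\<close> 70)
    and \<Delta> \<delta> :: "'v \<Rightarrow> ('k, 'v) tensor2" +
  assumes bialgebra_1: "\<Delta> (anticomm ast x y) =
        tensor_map scale id (Lstar ast x) (\<Delta> y) - tensor_map scale (Lop ast y) id (\<Delta> x)"
    and bialgebra_2: "\<Delta> (x \<ast> y) + \<tau> (\<Delta> (x \<ast> y)) =
        tensor_map scale (Lop ast x) id (\<Delta> y + \<tau> (\<Delta> y)) - tensor_map scale id (Rop ast y) (\<Delta> x)"
    and bialgebra_3: "\<delta> (commut circ x y) =
        (tensor_map scale id (ad circ x) (\<delta> y) - tensor_map scale (Lop circ x) id (\<delta> y))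
        - (tensor_map scale id (ad circ y) (\<delta> x) - tensor_map scale (Lop circ y) id (\<delta> x))"
    and bialgebra_4: "(\<lambda>t. t - \<tau> t)
        (\<delta> (x \<odot> y) - tensor_map scale (Lop circ x) id (\<delta> y)
         - tensor_map scale id (Lop circ x) (\<delta> y) + tensor_map scale id (Rop circ y) (\<delta> x)) = 0"
    and bialgebra_5: "\<delta> (anticomm ast x y) =
        tensor_map scale id (Lstar ast x) (\<delta> y) + tensor_map scale id (Lstar ast y) (\<delta> x)
        + tensor_map scale (Lop circ x) id (\<Delta> y) + tensor_map scale (Lop circ y) id (\<Delta> x)"
    and bialgebra_6: "\<Delta> (commut circ x y) =
        - tensor_map scale (Lop circ x) id (\<Delta> y) - tensor_map scale id (Lstar ast y) (\<delta> x)
        - tensor_map scale (Lop ast y) id (\<delta> x) + tensor_map scale id (ad circ x) (\<Delta> y)"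
    and bialgebra_7: "\<Delta> (x \<odot> y) + \<tau> (\<Delta> (x \<odot> y)) = (\<lambda>t. t + \<tau> t)
        (tensor_map scale (Lop circ x) id (\<Delta> y) + tensor_map scale id (Lop circ x) (\<Delta> y)
         + tensor_map scale id (Rop ast y) (\<delta> x))"
    and bialgebra_8: "\<delta> (x \<ast> y) - \<tau> (\<delta> (x \<ast> y)) =
        tensor_map scale id (Lop ast x) (\<delta> y) - \<tau> (tensor_map scale (Lop ast x) id (\<delta> y))
        - tensor_map scale (Lop circ x) id (\<Delta> y) - \<tau> (tensor_map scale id (Lop circ x) (\<Delta> y))
        - tensor_map scale id (Rop ast y) (\<delta> x) - \<tau> (tensor_map scale id (Rop circ y) (\<Delta> x))"


section \<open>Invariance and the APP-YBE\<close>

definition invariant_tensor ::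
  "('k::field \<Rightarrow> 'v::ab_group_add \<Rightarrow> 'v) \<Rightarrow> ('v \<Rightarrow> 'v \<Rightarrow> 'v) \<Rightarrow> ('v \<Rightarrow> 'v \<Rightarrow> 'v) \<Rightarrow> ('k, 'v) tensor2 \<Rightarrow> bool" where
  "invariant_tensor scale ast circ s \<longleftrightarrow>
     (\<forall>x. tensor_map scale id (Lstar ast x) s + tensor_map scale (Lop ast x) id s = 0 \<and>
          tensor_map scale (Lop circ x) id s - tensor_map scale id (ad circ x) s = 0)"

definition app_ybe ::
  "('k::field \<Rightarrow> 'v::ab_group_add \<Rightarrow> 'v) \<Rightarrow> ('v \<Rightarrow> 'v \<Rightarrow> 'v) \<Rightarrow> ('v \<Rightarrow> 'v \<Rightarrow> 'v) \<Rightarrow>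
   nat \<Rightarrow> (nat \<Rightarrow> 'v) \<Rightarrow> (nat \<Rightarrow> 'v) \<Rightarrow> bool" where
  "app_ybe scale ast circ n a b \<longleftrightarrow>
     (\<Sum>i<n. \<Sum>j<n. tensor3 scale (a i) (ast (b i) (a j)) (b j)
        - tensor3 scale (ast (a i) (a j)) (b i) (b j)
        + tensor3 scale (a i) (a j) (anticomm ast (b i) (b j))) = 0 \<and>
     (\<Sum>i<n. \<Sum>j<n. tensor3 scale (circ (a i) (a j)) (b i) (b j)
        + tensor3 scale (a i) (circ (b i) (a j)) (b j)
        - tensor3 scale (a i) (a j) (commut circ (b i) (b j))) = 0"

definition Delta_r ::
  "('k::field \<Rightarrow> 'v::ab_group_add \<Rightarrow> 'v) \<Rightarrow> ('v \<Rightarrow> 'v \<Rightarrow> 'v) \<Rightarrow> ('k, 'v) tensor2 \<Rightarrow> 'v \<Rightarrow> ('k, 'v) tensor2" where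
  "Delta_r scale ast r x = - (tensor_map scale id (Lstar ast x) r + tensor_map scale (Lop ast x) id r)"

definition delta_r ::
  "('k::field \<Rightarrow> 'v::ab_group_add \<Rightarrow> 'v) \<Rightarrow> ('v \<Rightarrow> 'v \<Rightarrow> 'v) \<Rightarrow> ('k, 'v) tensor2 \<Rightarrow> 'v \<Rightarrow> ('k, 'v) tensor2" where
  "delta_r scale circ r x = tensor_map scale (Lop circ x) id r - tensor_map scale id (ad circ x) r"

end

theory Submission
  imports Defs
begin

text \<open>Write \<open>D\<close> for the dual space \<open>A\<^sup>*\<close>. The tensor \<open>r = \<Sum> a\<^sub>i \<otimes> b\<^sub>i\<close> gives two maps \<open>P, N : D \<rightarrow> A\<close>,
  \<open>P \<zeta> = \<Sum> \<zeta> (a\<^sub>i) b\<^sub>i\<close> and \<open>N \<zeta> = - \<Sum> \<zeta> (b\<^sub>i) a\<^sub>i\<close>, related by \<open>\<eta> (P \<zeta>) = - \<zeta> (N \<eta>)\<close>; their difference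
  \<open>P - N\<close> comes from the symmetric tensor \<open>r + \<tau> r\<close>. The operations on \<open>D\<close> dual to \<open>\<Delta>\<^sub>r\<close> and \<open>\<delta>\<^sub>r\<close> are

  \<open>(\<zeta> \<ast> \<eta>) w = \<zeta> (w \<ast> N \<eta>) - \<eta> (w \<star> P \<zeta>)\<close> and \<open>(\<zeta> \<circ> \<eta>) w = - \<zeta> (w \<circ> N \<eta>) - \<eta> [w, P \<zeta>]\<close>.

  Invariance of \<open>r + \<tau> r\<close> says precisely that \<open>P\<close> and \<open>N\<close> may be interchanged in both formulas
  (\<open>Delta_PN\<close>, \<open>delta_PN\<close>). Given invariance, the APP-YBE makes both \<open>P\<close> and \<open>N\<close> homomorphisms for the
  two operations (\<open>P_ast\<close>, \<open>N_ast\<close>, \<open>P_circ\<close>, \<open>N_circ\<close>).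

  The axioms on \<open>D\<close> are trilinear in \<open>\<zeta>, \<eta>, \<theta>\<close>. Evaluated at \<open>w\<close>, a triple product is
  \<open>\<zeta> (\<dots>) + \<eta> (\<dots>) + \<theta> (\<dots>)\<close>, where the bracket after each functional is a product in \<open>A\<close> of \<open>w\<close> and the
  images of the other two functionals under \<open>P\<close> or \<open>N\<close>. The freedom to interchange \<open>P\<close> and \<open>N\<close> lets one
  choose these images uniformly for all ways to multiply three functionals: fix a linear order on
  them, and let each functional see \<open>N\<close> of the later ones and \<open>P\<close> of the earlier ones (\<open>left_triple\<close>,
  \<open>right_triple\<close>). Then an axiom on \<open>D\<close> splits into three identities in \<open>A\<close>, one for each functional.
  In the same way each compatibility condition between \<open>\<Delta>\<^sub>r\<close>, \<open>\<delta>\<^sub>r\<close> and the products of \<open>A\<close>, paired with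
  \<open>\<zeta> \<otimes> \<eta>\<close>, splits into one identity for \<open>\<zeta>\<close> and one for \<open>\<eta>\<close>; the terms of \<open>r\<close> with an operator on both
  tensor factors cancel by the relation between \<open>P\<close> and \<open>N\<close>.

  The identities in \<open>A\<close> that occur are its axioms and a few consequences of them, chiefly that
  \<open>(A, \<star>, [ , ])\<close> is a Poisson algebra.\<close>

section \<open>Linear functionals and tensors\<close>

lemma bilinear_op_onD:
  assumes "bilinear_op_on scale UNIV m"
  shows "m (x + y) z = m x z + m y z" "m x (y + z) = m x y + m x z"
    "m (scale c x) y = scale c (m x y)" "m x (scale c y) = scale c (m x y)"
    "m (- x) y = - m x y" "m x (- y) = - m x y"
    "m (x - y) z = m x z - m y z" "m x (y - z) = m x y - m x z"
proof -
  show add: "m (x + y) z = m x z + m y z" "m x (y + z) = m x y + m x z" for x y z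
    using assms by (auto simp: bilinear_op_on_def)
  show "m (scale c x) y = scale c (m x y)" "m x (scale c y) = scale c (m x y)"
    using assms by (auto simp: bilinear_op_on_def)
  interpret l: additive "\<lambda>x. m x y" for y by unfold_locales (rule add)
  interpret r: additive "m x" for x by unfold_locales (rule add)
  show "m (- x) y = - m x y" "m x (- y) = - m x y"
    "m (x - y) z = m x z - m y z" "m x (y - z) = m x y - m x z"
    by (rule l.minus r.minus l.diff r.diff)+
qed

lemmas functional_simps =
  dual_space_add dual_space_scale
  module_hom.neg [OF dual_space_module_hom]
  module_hom.diff [OF dual_space_module_hom]
  module_hom.zero [OF dual_space_module_hom]

lemma (in vector_space) dual_spaceI:
  assumes "\<And>x y. \<phi> (x + y) = \<phi> x + \<phi> y" "\<And>c x. \<phi> (scale c x) = c * \<phi> x"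
  shows "\<phi> \<in> dual_space scale"
  using assms vector_space_axioms
  by (auto simp: dual_space_def Vector_Spaces.linear_iff vector_space_def algebra_simps)

lemma (in vector_space) dual_space_separates:
  assumes "fd_vector_space scale UNIV" and "\<And>\<zeta>. \<zeta> \<in> dual_space scale \<Longrightarrow> \<zeta> u = \<zeta> v"
  shows "u = v"
proof -
  obtain B e where B: "\<And>b. b \<in> B \<Longrightarrow> e b \<in> dual_space scale" "\<And>v. v = (\<Sum>b\<in>B. scale (e b v) b)"
    using obtain_dual_basis[OF assms(1)] by metis
  have "u = (\<Sum>b\<in>B. scale (e b u) b)" by (rule B)
  also have "\<dots> = (\<Sum>b\<in>B. scale (e b v) b)"
    by (rule sum.cong) (simp_all add: assms(2)[OF B(1)])
  also have "\<dots> = v" by (rule B(2)[symmetric])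
  finally show ?thesis .
qed

lemma flip_simps:
  "\<tau> (s + t) = \<tau> s + \<tau> t" "\<tau> (s - t) = \<tau> s - \<tau> t"
  "\<tau> (tensor_map scale f g t) = tensor_map scale g f (\<tau> t)"
  by (auto simp: flip_def tensor_map_def fun_eq_iff)

lemma op_lambda:
  "Lop m x = (\<lambda>y. m x y)" "Rop m x = (\<lambda>y. m y x)"
  "Lstar ast x = (\<lambda>y. anticomm ast x y)" "ad circ x = (\<lambda>y. commut circ x y)"
  by (auto simp: Lop_def Rop_def Lstar_def ad_def anticomm_def commut_def)

lemma op_apply:
  "Lop m x y = m x y" "Rop m x y = m y x" "Lstar ast x y = anticomm ast x y" "ad circ x y = commut circ x y"
  by (simp_all add: op_lambda)

context vector_space
begin

lemma tensor_space_zero: "0 \<in> tensor_space scale"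
  by (simp add: tensor_space_def)

lemma tensor_space_plus:
  "\<lbrakk>s \<in> tensor_space scale; t \<in> tensor_space scale\<rbrakk> \<Longrightarrow> s + t \<in> tensor_space scale"
  by (auto simp: tensor_space_def algebra_simps)

lemma tensor_space_minus: "t \<in> tensor_space scale \<Longrightarrow> - t \<in> tensor_space scale"
  by (auto simp: tensor_space_def)

lemma tensor_space_tensor_map:
  assumes t: "t \<in> tensor_space scale"
    and f: "\<And>\<zeta>. \<zeta> \<in> dual_space scale \<Longrightarrow> \<zeta> \<circ> f \<in> dual_space scale"
    and g: "\<And>\<zeta>. \<zeta> \<in> dual_space scale \<Longrightarrow> \<zeta> \<circ> g \<in> dual_space scale"
  shows "tensor_map scale f g t \<in> tensor_space scale"
proof -
  have comp: "(\<zeta> + \<eta>) \<circ> h = (\<zeta> \<circ> h) + (\<eta> \<circ> h)" "dual_scale c \<zeta> \<circ> h = dual_scale c (\<zeta> \<circ> h)"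
    for \<zeta> \<eta> :: "'b \<Rightarrow> 'a" and c h by (auto simp: dual_scale_apply)
  show ?thesis
    using t f g unfolding tensor_space_def mem_Collect_eq tensor_map_def
    by (simp add: comp dual_space_plus dual_space_dual_scale)
qed

lemma dual_space_minus: "\<zeta> \<in> dual_space scale \<Longrightarrow> - \<zeta> \<in> dual_space scale"
  using dual_space_dual_scale[of \<zeta> "-1"] by (simp add: dual_scale_def fun_Compl_def)

lemma dual_space_diff: "\<lbrakk>\<zeta> \<in> dual_space scale; \<eta> \<in> dual_space scale\<rbrakk> \<Longrightarrow> \<zeta> - \<eta> \<in> dual_space scale"
  using dual_space_plus[of \<zeta> "- \<eta>"] dual_space_minus[of \<eta>] by simp

lemma tensor_space_simps:
  assumes t: "t \<in> tensor_space scale" and D: "\<zeta> \<in> dual_space scale" "\<eta> \<in> dual_space scale" "\<theta> \<in> dual_space scale"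
  shows "t (\<zeta> + \<eta>) \<theta> = t \<zeta> \<theta> + t \<eta> \<theta>" "t \<theta> (\<zeta> + \<eta>) = t \<theta> \<zeta> + t \<theta> \<eta>"
    "t (\<zeta> - \<eta>) \<theta> = t \<zeta> \<theta> - t \<eta> \<theta>" "t \<theta> (\<zeta> - \<eta>) = t \<theta> \<zeta> - t \<theta> \<eta>"
proof -
  have *: "t (\<zeta> + \<eta>) \<theta> = t \<zeta> \<theta> + t \<eta> \<theta>" "t \<theta> (\<zeta> + \<eta>) = t \<theta> \<zeta> + t \<theta> \<eta>"
    if "\<zeta> \<in> dual_space scale" for \<zeta>
    using t D that by (auto simp: tensor_space_def)
  show "t (\<zeta> + \<eta>) \<theta> = t \<zeta> \<theta> + t \<eta> \<theta>" "t \<theta> (\<zeta> + \<eta>) = t \<theta> \<zeta> + t \<theta> \<eta>"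
    by (rule *[OF D(1)])+
  show "t (\<zeta> - \<eta>) \<theta> = t \<zeta> \<theta> - t \<eta> \<theta>" "t \<theta> (\<zeta> - \<eta>) = t \<theta> \<zeta> - t \<theta> \<eta>"
    using *[OF dual_space_diff[OF D(1,2)]] by simp_all
qed

text \<open>A map into \<open>A \<otimes> A\<close> is linear as soon as its pairings with pure tensors of functionals are,
  since tensors vanish on all other arguments.\<close>

lemma linear_tensorI:
  assumes "\<And>x. \<Gamma> x \<in> tensor_space scale"
    and "\<And>\<zeta> \<eta>. \<lbrakk>\<zeta> \<in> dual_space scale; \<eta> \<in> dual_space scale\<rbrakk> \<Longrightarrow> (\<lambda>x. \<Gamma> x \<zeta> \<eta>) \<in> dual_space scale"
  shows "Vector_Spaces.linear scale tensor_scale \<Gamma>"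
proof -
  have off: "\<Gamma> x \<zeta> \<eta> = 0" if "\<not> (\<zeta> \<in> dual_space scale \<and> \<eta> \<in> dual_space scale)" for x \<zeta> \<eta>
    using assms(1)[of x] that by (auto simp: tensor_space_def)
  have "\<Gamma> (x + y) \<zeta> \<eta> = \<Gamma> x \<zeta> \<eta> + \<Gamma> y \<zeta> \<eta>" "\<Gamma> (scale c x) \<zeta> \<eta> = c * \<Gamma> x \<zeta> \<eta>" for x y c \<zeta> \<eta>
    using dual_space_add[OF assms(2)[of \<zeta> \<eta>]] dual_space_scale[OF assms(2)[of \<zeta> \<eta>]] off[of \<zeta> \<eta>]
    by (cases "\<zeta> \<in> dual_space scale \<and> \<eta> \<in> dual_space scale"; simp)+
  then show ?thesis
    using vector_space_axioms vector_space_tensor_scale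
    by (auto simp: Vector_Spaces.linear_iff tensor_scale_def fun_eq_iff)
qed

lemma fd_dual_space:
  assumes "fd_vector_space scale UNIV"
  shows "fd_vector_space (dual_scale :: 'a \<Rightarrow> ('b \<Rightarrow> 'a) \<Rightarrow> _) (dual_space scale)"
proof -
  interpret dual: vector_space "dual_scale :: 'a \<Rightarrow> ('b \<Rightarrow> 'a) \<Rightarrow> _" by (rule vector_space_dual_scale)
  obtain B e where B: "finite B" "\<And>b. b \<in> B \<Longrightarrow> e b \<in> dual_space scale"
    "\<And>v. v = (\<Sum>b\<in>B. scale (e b v) b)"
    using obtain_dual_basis[OF assms] by metis
  have "dual.span (e ` B) = dual_space scale"
  proof
    have "dual.subspace (dual_space scale)"
      by (simp add: dual.subspace_def dual_space_zero dual_space_plus dual_space_dual_scale)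
    then show "dual.span (e ` B) \<subseteq> dual_space scale"
      using B(2) by (intro dual.span_minimal) auto
    show "dual_space scale \<subseteq> dual.span (e ` B)"
    proof
      fix \<zeta> assume "\<zeta> \<in> dual_space scale"
      then have "\<zeta> = (\<Sum>b\<in>B. dual_scale (\<zeta> b) (e b))"
        by (rule dual_space_expand) (rule B(3))
      also have "\<dots> \<in> dual.span (e ` B)"
        by (intro dual.span_sum dual.span_scale dual.span_base) auto
      finally show "\<zeta> \<in> dual.span (e ` B)" .
    qed
  qed
  then show ?thesis
    using B(1) by unfold_locales blast
qed

end

lemma (in vector_space) dual_op_bilinear:
  assumes "Vector_Spaces.linear scale tensor_scale \<Gamma>" "range \<Gamma> \<subseteq> tensor_space scale"
  shows "\<lbrakk>\<zeta> \<in> dual_space scale; \<eta> \<in> dual_space scale\<rbrakk> \<Longrightarrow> dual_op \<Gamma> \<zeta> \<eta> \<in> dual_space scale"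
    and "bilinear_op_on dual_scale (dual_space scale) (dual_op \<Gamma>)"
proof -
  show cl: "dual_op \<Gamma> \<zeta> \<eta> \<in> dual_space scale" for \<zeta> \<eta>
    using assms(1) by (intro dual_spaceI) (simp_all add: Vector_Spaces.linear_iff dual_op_def tensor_scale_def)
  have "\<Gamma> x \<in> tensor_space scale" for x using assms(2) by auto
  then show "bilinear_op_on dual_scale (dual_space scale) (dual_op \<Gamma>)"
    using cl by (auto simp: bilinear_op_on_def dual_op_def tensor_space_def fun_eq_iff dual_scale_apply)
qed

text \<open>These two rules name the identities from which an equation between values of functionals
  follows, and the functional that each of them is fed to. What remains is an identity
  between expanded sums.\<close>

lemma eq_by_two_equations:
  fixes L R :: "'b::ab_group_add"
  assumes "u = u'" "v = v'" "L - R = (\<zeta> u - \<zeta> u') + (\<eta> v - \<eta> v')"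
  shows "L = R"
  using assms by simp

lemma eq_by_three_equations:
  fixes L R :: "'b::ab_group_add"
  assumes "u = u'" "v = v'" "w = w'" "L - R = (\<zeta> u - \<zeta> u') + (\<eta> v - \<eta> v') + (\<theta> w - \<theta> w')"
  shows "L = R"
  using assms by simp

section \<open>Anti-pre-Poisson algebras\<close>

locale app_algebra = anti_pre_poisson_algebra scale UNIV ast circ
  for scale :: "'k::field \<Rightarrow> 'v::ab_group_add \<Rightarrow> 'v"
    and ast :: "'v \<Rightarrow> 'v \<Rightarrow> 'v"  (infixl \<open>\<ast>\<close> 70)
    and circ :: "'v \<Rightarrow> 'v \<Rightarrow> 'v"  (infixl \<open>\<odot>\<close> 70)
begin

abbreviation star (infixl \<open>\<star>\<close> 70) where "x \<star> y \<equiv> anticomm (\<ast>) x y"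
abbreviation bracket (\<open>\<lbrakk>_,/ _\<rbrakk>\<close>) where "\<lbrakk>x, y\<rbrakk> \<equiv> commut (\<odot>) x y"

lemmas ast_simps = bilinear_op_onD[OF bilinear_ast]
lemmas circ_simps = bilinear_op_onD[OF bilinear_circ]

lemma star_simps:
  "(x + y) \<star> z = x \<star> z + y \<star> z" "x \<star> (y + z) = x \<star> y + x \<star> z"
  "scale c x \<star> y = scale c (x \<star> y)" "x \<star> scale c y = scale c (x \<star> y)"
  "(- x) \<star> y = - (x \<star> y)" "x \<star> (- y) = - (x \<star> y)"
  "(x - y) \<star> z = x \<star> z - y \<star> z" "x \<star> (y - z) = x \<star> y - x \<star> z"
  by (simp_all add: anticomm_def ast_simps scale_right_distrib algebra_simps)

lemma bracket_simps:
  "\<lbrakk>x + y, z\<rbrakk> = \<lbrakk>x, z\<rbrakk> + \<lbrakk>y, z\<rbrakk>" "\<lbrakk>x, y + z\<rbrakk> = \<lbrakk>x, y\<rbrakk> + \<lbrakk>x, z\<rbrakk>"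
  "\<lbrakk>scale c x, y\<rbrakk> = scale c \<lbrakk>x, y\<rbrakk>" "\<lbrakk>x, scale c y\<rbrakk> = scale c \<lbrakk>x, y\<rbrakk>"
  "\<lbrakk>- x, y\<rbrakk> = - \<lbrakk>x, y\<rbrakk>" "\<lbrakk>x, - y\<rbrakk> = - \<lbrakk>x, y\<rbrakk>"
  "\<lbrakk>x - y, z\<rbrakk> = \<lbrakk>x, z\<rbrakk> - \<lbrakk>y, z\<rbrakk>" "\<lbrakk>x, y - z\<rbrakk> = \<lbrakk>x, y\<rbrakk> - \<lbrakk>x, z\<rbrakk>"
  by (simp_all add: commut_def circ_simps scale_right_diff_distrib algebra_simps)

lemmas op_simps = ast_simps circ_simps star_simps bracket_simps

lemma star_commute: "x \<star> y = y \<star> x"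
  by (simp add: anticomm_def add.commute)

lemma bracket_swap: "\<lbrakk>x, y\<rbrakk> = - \<lbrakk>y, x\<rbrakk>"
  by (simp add: commut_def)

lemma star_ast: "(x \<star> y) \<ast> z = - (x \<ast> (y \<ast> z))"
  using anti_zinbiel(1)[of x y z] by (simp add: anticomm_def)

lemma ast_ast_reverse: "x \<ast> (y \<ast> z) = z \<ast> (y \<ast> x)"
  using anti_zinbiel(1-3)[of x y z] by simp

lemma ast_left_commute: "x \<ast> (y \<ast> z) = y \<ast> (x \<ast> z)"
  using anti_zinbiel(4)[of y z x] by simp

text \<open>By the anti-Zinbiel law \<open>x \<ast> (y \<ast> z)\<close> is symmetric in its three arguments. In
  \<open>x \<star> (y \<star> z)\<close> this symmetric product occurs twice with sign \<open>+\<close> and once, through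
  \<open>(y \<star> z) \<ast> x\<close>, with sign \<open>-\<close>.\<close>

lemma star_star_ast: "x \<star> (y \<star> z) = z \<ast> (x \<ast> y)"
proof -
  have "x \<star> (y \<star> z) = x \<ast> (y \<ast> z) + x \<ast> (z \<ast> y) + (y \<star> z) \<ast> x"
    by (simp add: anticomm_def ast_simps)
  also have "\<dots> = x \<ast> (y \<ast> z)"
    unfolding star_ast ast_ast_reverse[of y z x] by simp
  also have "\<dots> = z \<ast> (x \<ast> y)"
    unfolding ast_left_commute[of x y z] by (rule ast_ast_reverse)
  finally show ?thesis .
qed

lemma star_assoc: "(x \<star> y) \<star> z = x \<star> (y \<star> z)"
proof -
  have "(x \<star> y) \<star> z = y \<ast> (z \<ast> x)"
    unfolding star_commute[of _ z] by (rule star_star_ast)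
  also have "\<dots> = z \<ast> (x \<ast> y)"
    unfolding ast_ast_reverse[of y z x] by (rule ast_left_commute)
  finally show ?thesis
    by (simp only: star_star_ast)
qed

lemma circ_circ: "x \<odot> (y \<odot> z) - y \<odot> (x \<odot> z) = \<lbrakk>y, x\<rbrakk> \<odot> z"
  by (rule anti_pre_lie) auto

lemma bracket_circ_cyclic: "\<lbrakk>x, y\<rbrakk> \<odot> z + \<lbrakk>y, z\<rbrakk> \<odot> x + \<lbrakk>z, x\<rbrakk> \<odot> y = 0"
  by (rule anti_pre_lie) auto

lemma bracket_ast: "\<lbrakk>x, y\<rbrakk> \<ast> z = y \<ast> (x \<odot> z) - x \<odot> (y \<ast> z)"
  using anti_pre_poisson(1)[of x y z] by (simp add: commut_def)

lemma star_circ: "(x \<star> y) \<odot> z = - (x \<ast> (y \<odot> z)) - y \<ast> (x \<odot> z)"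
  using anti_pre_poisson(2)[of x y z] by (simp add: anticomm_def)

lemma circ_star: "z \<odot> (x \<star> y) = x \<ast> \<lbrakk>z, y\<rbrakk> + y \<ast> \<lbrakk>z, x\<rbrakk>"
  using anti_pre_poisson(3)[of x y z]
  by (simp add: anticomm_def commut_def ast_simps algebra_simps)

text \<open>The left-hand side of \<open>bracket_ast\<close> is antisymmetric in \<open>x\<close> and \<open>y\<close>; symmetrizing its
  right-hand side gives \<open>0\<close>, and the terms \<open>y \<ast> (x \<odot> z) + x \<ast> (y \<odot> z)\<close> that occur are those of \<open>star_circ\<close>.\<close>

lemma circ_ast_symmetrized: "x \<odot> (y \<ast> z) + y \<odot> (x \<ast> z) = - ((x \<star> y) \<odot> z)"
proof -
  have "\<lbrakk>x, y\<rbrakk> \<ast> z + \<lbrakk>y, x\<rbrakk> \<ast> z = 0"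
    by (simp add: bracket_swap[of x y] ast_simps)
  then show ?thesis
    unfolding bracket_ast star_circ by (simp add: algebra_simps)
qed

text \<open>Two evaluations of \<open>x \<odot> (y \<star> z)\<close> are compared: as a whole, and summand by summand.\<close>

lemma bracket_ast_symmetrized: "\<lbrakk>x, y\<rbrakk> \<ast> z + \<lbrakk>x, z\<rbrakk> \<ast> y = - ((y \<star> z) \<odot> x)"
proof -
  have "x \<odot> (y \<star> z) = x \<odot> (y \<ast> z) + x \<odot> (z \<ast> y)"
    by (simp add: anticomm_def circ_simps)
  then show ?thesis
    unfolding circ_star star_circ bracket_ast by (simp add: commut_def ast_simps algebra_simps)
qed

text \<open>Expand the outer bracket on the left-hand side: the terms \<open>x \<odot> (y \<odot> z)\<close> and \<open>x \<odot> (z \<odot> y)\<close> are traded by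
  the first anti-pre-Lie law for products of the form \<open>\<lbrakk> , \<rbrakk> \<odot> \<cdot>\<close>, whose cyclic sum vanishes by the
  second.\<close>

lemma bracket_bracket: "\<lbrakk>x, \<lbrakk>y, z\<rbrakk>\<rbrakk> = y \<odot> (x \<odot> z) - z \<odot> (x \<odot> y)"
proof -
  have "\<lbrakk>x, \<lbrakk>y, z\<rbrakk>\<rbrakk> - (y \<odot> (x \<odot> z) - z \<odot> (x \<odot> y)) =
    (x \<odot> (y \<odot> z) - y \<odot> (x \<odot> z) - \<lbrakk>y, x\<rbrakk> \<odot> z) + (z \<odot> (x \<odot> y) - x \<odot> (z \<odot> y) - \<lbrakk>x, z\<rbrakk> \<odot> y)
    - (\<lbrakk>x, y\<rbrakk> \<odot> z + \<lbrakk>y, z\<rbrakk> \<odot> x + \<lbrakk>z, x\<rbrakk> \<odot> y)"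
    by (simp add: commut_def circ_simps algebra_simps)
  then show ?thesis
    unfolding circ_circ bracket_circ_cyclic by simp
qed

lemma jacobi: "\<lbrakk>x, \<lbrakk>y, z\<rbrakk>\<rbrakk> = \<lbrakk>\<lbrakk>x, y\<rbrakk>, z\<rbrakk> + \<lbrakk>y, \<lbrakk>x, z\<rbrakk>\<rbrakk>"
proof -
  have "\<lbrakk>\<lbrakk>x, y\<rbrakk>, z\<rbrakk> + \<lbrakk>y, \<lbrakk>x, z\<rbrakk>\<rbrakk> = x \<odot> \<lbrakk>y, z\<rbrakk> - (z \<odot> (y \<odot> x) - y \<odot> (z \<odot> x))"
    unfolding bracket_swap[of "\<lbrakk>x, y\<rbrakk>"] bracket_bracket by (simp add: commut_def circ_simps)
  also have "\<dots> = \<lbrakk>x, \<lbrakk>y, z\<rbrakk>\<rbrakk>"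
    unfolding circ_circ by (simp only: commut_def)
  finally show ?thesis ..
qed

lemma leibniz: "\<lbrakk>x, y \<star> z\<rbrakk> = \<lbrakk>x, y\<rbrakk> \<star> z + y \<star> \<lbrakk>x, z\<rbrakk>"
proof -
  have "\<lbrakk>x, y \<star> z\<rbrakk> = x \<odot> (y \<star> z) - (y \<star> z) \<odot> x" by (simp only: commut_def)
  also have "\<dots> = (y \<ast> \<lbrakk>x, z\<rbrakk> + z \<ast> \<lbrakk>x, y\<rbrakk>) + (\<lbrakk>x, y\<rbrakk> \<ast> z + \<lbrakk>x, z\<rbrakk> \<ast> y)"
    unfolding circ_star bracket_ast_symmetrized by simp
  finally show ?thesis by (simp only: anticomm_def ac_simps)
qed

lemma circ_star_cyclic: "x \<odot> (y \<star> z) + y \<odot> (z \<star> x) + z \<odot> (x \<star> y) = 0"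
  unfolding circ_star by (simp add: commut_def ast_simps)

lemma bracket_star_cyclic: "\<lbrakk>x, y \<star> z\<rbrakk> + \<lbrakk>y, z \<star> x\<rbrakk> + \<lbrakk>z, x \<star> y\<rbrakk> = 0"
  unfolding leibniz by (simp add: anticomm_def commut_def op_simps)

end

section \<open>Triple products on the dual space\<close>

text \<open>\<open>letter P N i j \<zeta>\<close> is the element of \<open>A\<close> by which a functional of rank \<open>j\<close> enters the argument of a
  functional of rank \<open>i\<close>: the later functional enters through \<open>N\<close>, the earlier one through \<open>P\<close>.\<close>

definition letter :: "('d \<Rightarrow> 'v) \<Rightarrow> ('d \<Rightarrow> 'v) \<Rightarrow> nat \<Rightarrow> nat \<Rightarrow> 'd \<Rightarrow> 'v" where
  "letter P N i j \<zeta> = (if i < j then N \<zeta> else P \<zeta>)"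

text \<open>The common features of the two operations on the dual space. The function \<open>m\<close> is the product of \<open>A\<close>
  to which \<open>pr\<close> corresponds under \<open>P\<close> and \<open>N\<close>, and \<open>f\<close>, \<open>g\<close> describe how the two factors of \<open>pr\<close> act on
  one another: \<open>(f, g)\<close> is \<open>(\<ast>, - \<star>)\<close> for \<open>m = \<ast>\<close> and \<open>(- \<odot>, - [ , ])\<close> for \<open>m = \<odot>\<close>. The agreement of
  \<open>pr_PN\<close> and \<open>pr_NP\<close> is the invariance of the symmetric part of \<open>r\<close>, and \<open>twist\<close> is the same
  invariance written as an intertwining property of \<open>P - N\<close>.\<close>

locale coadjoint_product = vector_space scale
  for scale :: "'k::field \<Rightarrow> 'v::ab_group_add \<Rightarrow> 'v" +
  fixes P N :: "('v \<Rightarrow> 'k) \<Rightarrow> 'v"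
    and m f g :: "'v \<Rightarrow> 'v \<Rightarrow> 'v"
    and pr :: "('v \<Rightarrow> 'k) \<Rightarrow> ('v \<Rightarrow> 'k) \<Rightarrow> 'v \<Rightarrow> 'k"
  assumes pr_PN: "\<lbrakk>\<alpha> \<in> dual_space scale; \<beta> \<in> dual_space scale\<rbrakk> \<Longrightarrow> pr \<alpha> \<beta> w = \<alpha> (f w (N \<beta>)) + \<beta> (g w (P \<alpha>))"
    and pr_NP: "\<lbrakk>\<alpha> \<in> dual_space scale; \<beta> \<in> dual_space scale\<rbrakk> \<Longrightarrow> pr \<alpha> \<beta> w = \<alpha> (f w (P \<beta>)) + \<beta> (g w (N \<alpha>))"
    and pr_dual: "\<lbrakk>\<alpha> \<in> dual_space scale; \<beta> \<in> dual_space scale\<rbrakk> \<Longrightarrow> pr \<alpha> \<beta> \<in> dual_space scale"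
    and P_pr: "\<lbrakk>\<alpha> \<in> dual_space scale; \<beta> \<in> dual_space scale\<rbrakk> \<Longrightarrow> P (pr \<alpha> \<beta>) = m (P \<alpha>) (P \<beta>)"
    and N_pr: "\<lbrakk>\<alpha> \<in> dual_space scale; \<beta> \<in> dual_space scale\<rbrakk> \<Longrightarrow> N (pr \<alpha> \<beta>) = m (N \<alpha>) (N \<beta>)"
    and twist_dual: "\<theta> \<in> dual_space scale \<Longrightarrow> (\<lambda>u. \<theta> (g u p)) \<in> dual_space scale"
    and twist: "\<theta> \<in> dual_space scale \<Longrightarrow>
      P (\<lambda>u. \<theta> (g u p)) - N (\<lambda>u. \<theta> (g u p)) = m p (P \<theta>) - m p (N \<theta>)"
    and f_diff: "f w (u - v) = f w u - f w v"
    and g_diff: "g w (u - v) = g w u - g w v"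
begin

lemma invariance:
  assumes "\<alpha> \<in> dual_space scale" "\<beta> \<in> dual_space scale"
  shows "\<alpha> (f w (P \<beta>)) + \<beta> (g w (N \<alpha>)) = \<alpha> (f w (N \<beta>)) + \<beta> (g w (P \<alpha>))"
  using pr_PN[OF assms] pr_NP[OF assms] by simp

text \<open>In a triple product whose singled-out factor \<open>\<eta>\<close> is the middle one in the chosen order, the two
  inner factors should see \<open>\<eta>\<close> through different maps, so neither of the two forms of the outer product
  gives the right letters. Correcting one letter of \<open>\<eta>\<close> costs a term in \<open>P \<eta> - N \<eta>\<close> under \<open>\<theta>\<close>;
  moving \<open>P - N\<close> from \<open>\<eta>\<close> to \<open>\<theta>\<close> through both operations turns it into the term in
  \<open>P \<theta> - N \<theta>\<close> under \<open>\<eta>\<close> that corrects the last letter. The functions \<open>F\<close> and \<open>G\<close> stand for \<open>f w\<close> and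
  \<open>g w\<close> of the outer product, in either order.\<close>

lemma exchange:
  assumes D: "\<eta> \<in> dual_space scale" "\<theta> \<in> dual_space scale"
    and swap: "\<And>\<phi>. \<phi> \<in> dual_space scale \<Longrightarrow> \<phi> (F (P \<eta>)) + \<eta> (G (N \<phi>)) = \<phi> (F (N \<eta>)) + \<eta> (G (P \<phi>))"
    and G_diff: "\<And>u v. G (u - v) = G u - G v"
  shows "\<theta> (g (F (P \<eta>)) p) + \<eta> (G (m p (N \<theta>))) = \<theta> (g (F (N \<eta>)) p) + \<eta> (G (m p (P \<theta>)))"
proof -
  let ?\<phi> = "\<lambda>u. \<theta> (g u p)"
  have "?\<phi> (F (P \<eta>)) + \<eta> (G (N ?\<phi>)) = ?\<phi> (F (N \<eta>)) + \<eta> (G (P ?\<phi>))"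
    by (rule swap[OF twist_dual[OF D(2)]])
  moreover have "\<eta> (G (P ?\<phi>)) - \<eta> (G (N ?\<phi>)) = \<eta> (G (m p (P \<theta>))) - \<eta> (G (m p (N \<theta>)))"
    using arg_cong[OF twist[OF D(2), of p], of "\<lambda>u. \<eta> (G u)"] D(1)
    by (simp add: G_diff functional_simps)
  ultimately show ?thesis by algebra
qed

end

locale coadjoint_product_pair =
  inner: coadjoint_product scale P N m1 f1 g1 pr1 + outer: coadjoint_product scale P N m2 f2 g2 pr2
  for scale :: "'k::field \<Rightarrow> 'v::ab_group_add \<Rightarrow> 'v" and P N m1 f1 g1 pr1 m2 f2 g2 pr2
begin

text \<open>If \<open>\<gamma>\<close> is the first or the last of the three, then \<open>\<alpha>\<close> and \<open>\<beta>\<close> see it through the same map and it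
  suffices to choose suitable forms of the inner and the outer product. If \<open>\<gamma>\<close> lies between \<open>\<alpha>\<close> and
  \<open>\<beta>\<close>, the letters that are still wrong are corrected by \<open>exchange\<close>.\<close>

lemma left_triple:
  assumes "distinct [i, j, k]"
    and D: "\<alpha> \<in> dual_space scale" "\<beta> \<in> dual_space scale" "\<gamma> \<in> dual_space scale"
  shows "pr2 (pr1 \<alpha> \<beta>) \<gamma> w =
    \<alpha> (f1 (f2 w (letter P N i k \<gamma>)) (letter P N i j \<beta>)) + \<beta> (g1 (f2 w (letter P N j k \<gamma>)) (letter P N j i \<alpha>))
    + \<gamma> (g2 w (m1 (letter P N k i \<alpha>) (letter P N k j \<beta>)))"
proof -
  note PN = inner.pr_PN[OF D(1,2)] outer.pr_PN[OF inner.pr_dual[OF D(1,2)] D(3)]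
  note NP = inner.pr_NP[OF D(1,2)] outer.pr_NP[OF inner.pr_dual[OF D(1,2)] D(3)]
  note hom = inner.P_pr[OF D(1,2)] inner.N_pr[OF D(1,2)]
  have exchange_f: "\<beta> (g1 (f2 w (P \<gamma>)) p) + \<gamma> (g2 w (m1 p (N \<beta>))) =
      \<beta> (g1 (f2 w (N \<gamma>)) p) + \<gamma> (g2 w (m1 p (P \<beta>)))" for w p
    by (rule inner.exchange[OF D(3,2) outer.invariance[OF _ D(3)] outer.g_diff])
  consider "i < j" "i < k" "j < k" | "j < i" "i < k" "j < k" | "i < j" "k < i" "k < j" | "j < i" "k < i" "k < j"
    | "i < k" "k < j" | "j < k" "k < i"
    using assms(1) by fastforce
  then show ?thesis
  proof cases
    case 1
    then show ?thesis by (simp add: letter_def PN hom)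
  next
    case 2
    then show ?thesis by (simp add: letter_def NP(1) PN(2) hom)
  next
    case 3
    then show ?thesis by (simp add: letter_def PN(1) NP(2) hom)
  next
    case 4
    then show ?thesis by (simp add: letter_def NP hom)
  next
    case 5
    then show ?thesis
      using exchange_f[of w "P \<alpha>"] by (simp add: letter_def PN hom algebra_simps)
  next
    case 6
    then show ?thesis
      using exchange_f[of w "N \<alpha>"] by (simp add: letter_def NP hom algebra_simps)
  qed
qed

lemma right_triple:
  assumes "distinct [i, j, k]"
    and D: "\<alpha> \<in> dual_space scale" "\<beta> \<in> dual_space scale" "\<gamma> \<in> dual_space scale"
  shows "pr2 \<gamma> (pr1 \<alpha> \<beta>) w =
    \<gamma> (f2 w (m1 (letter P N k i \<alpha>) (letter P N k j \<beta>)))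
    + \<alpha> (f1 (g2 w (letter P N i k \<gamma>)) (letter P N i j \<beta>)) + \<beta> (g1 (g2 w (letter P N j k \<gamma>)) (letter P N j i \<alpha>))"
proof -
  note PN = inner.pr_PN[OF D(1,2)] outer.pr_PN[OF D(3) inner.pr_dual[OF D(1,2)]]
  note NP = inner.pr_NP[OF D(1,2)] outer.pr_NP[OF D(3) inner.pr_dual[OF D(1,2)]]
  note hom = inner.P_pr[OF D(1,2)] inner.N_pr[OF D(1,2)]
  have exchange_g: "\<beta> (g1 (g2 w (P \<gamma>)) p) + \<gamma> (f2 w (m1 p (N \<beta>))) =
      \<beta> (g1 (g2 w (N \<gamma>)) p) + \<gamma> (f2 w (m1 p (P \<beta>)))" for w p
    by (rule inner.exchange[OF D(3,2) _ outer.f_diff])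
      (use outer.invariance[OF D(3)] in \<open>simp only: add.commute\<close>)
  consider "i < j" "i < k" "j < k" | "j < i" "i < k" "j < k" | "i < j" "k < i" "k < j" | "j < i" "k < i" "k < j"
    | "i < k" "k < j" | "j < k" "k < i"
    using assms(1) by fastforce
  then show ?thesis
  proof cases
    case 1
    then show ?thesis by (simp add: letter_def PN(1) NP(2) hom)
  next
    case 2
    then show ?thesis by (simp add: letter_def NP hom)
  next
    case 3
    then show ?thesis by (simp add: letter_def PN hom)
  next
    case 4
    then show ?thesis by (simp add: letter_def NP(1) PN(2) hom)
  next
    case 5
    then show ?thesis
      using exchange_g[of w "P \<alpha>"] by (simp add: letter_def PN(1) NP(2) hom algebra_simps)
  next
    case 6
    then show ?thesis
      using exchange_g[of w "N \<alpha>"] by (simp add: letter_def NP(1) PN(2) hom algebra_simps)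
  qed
qed

end

section \<open>Invariance of the symmetric part\<close>

text \<open>\<open>P\<close> and \<open>N\<close> are the two contractions of \<open>r\<close>. The sign of \<open>N\<close> is chosen such that both maps become
  homomorphisms under the APP-YBE.\<close>

locale invariant_pairing = app_algebra scale ast circ
  for scale :: "'k::field \<Rightarrow> 'v::ab_group_add \<Rightarrow> 'v"
    and ast :: "'v \<Rightarrow> 'v \<Rightarrow> 'v"  (infixl \<open>\<ast>\<close> 70)
    and circ :: "'v \<Rightarrow> 'v \<Rightarrow> 'v"  (infixl \<open>\<odot>\<close> 70) +
  fixes P N :: "('v \<Rightarrow> 'k) \<Rightarrow> 'v" and r :: "('k, 'v) tensor2"
  assumes r_tensor: "r \<in> tensor_space scale"
    and r_P: "\<lbrakk>\<zeta> \<in> dual_space scale; \<eta> \<in> dual_space scale\<rbrakk> \<Longrightarrow> r \<zeta> \<eta> = \<eta> (P \<zeta>)"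
    and r_N: "\<lbrakk>\<zeta> \<in> dual_space scale; \<eta> \<in> dual_space scale\<rbrakk> \<Longrightarrow> r \<zeta> \<eta> = - \<zeta> (N \<eta>)"
    and invariant: "invariant_tensor scale ast circ (r + \<tau> r)"
begin

abbreviation "D \<equiv> dual_space scale"
abbreviation "\<Delta> \<equiv> Delta_r scale ast r"
abbreviation "\<delta> \<equiv> delta_r scale circ r"

lemma dual_lambda:
  assumes "\<zeta> \<in> D"
  shows "(\<lambda>u. \<zeta> (x \<ast> u)) \<in> D" "(\<lambda>u. \<zeta> (u \<ast> x)) \<in> D" "(\<lambda>u. \<zeta> (x \<odot> u)) \<in> D" "(\<lambda>u. \<zeta> (u \<odot> x)) \<in> D"
    "(\<lambda>u. \<zeta> (x \<star> u)) \<in> D" "(\<lambda>u. \<zeta> \<lbrakk>x, u\<rbrakk>) \<in> D"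
  by (rule dual_spaceI; simp add: op_simps functional_simps[OF assms])+

lemma dual_comp:
  assumes "\<zeta> \<in> D"
  shows "\<zeta> \<circ> Lop ast x \<in> D" "\<zeta> \<circ> Rop ast x \<in> D" "\<zeta> \<circ> Lstar ast x \<in> D"
    "\<zeta> \<circ> Lop circ x \<in> D" "\<zeta> \<circ> Rop circ x \<in> D" "\<zeta> \<circ> ad circ x \<in> D"
  unfolding op_lambda comp_def by (rule dual_lambda[OF assms])+

lemma adjoint: "\<lbrakk>\<zeta> \<in> D; \<eta> \<in> D\<rbrakk> \<Longrightarrow> \<zeta> (N \<eta>) = - \<eta> (P \<zeta>)"
  using r_P r_N by (metis minus_minus)

lemma symmetric_part:
  assumes "\<zeta> \<in> D" "\<eta> \<in> D"
  shows "(r + \<tau> r) \<zeta> \<eta> = \<eta> (P \<zeta>) - \<eta> (N \<zeta>)" "(r + \<tau> r) \<zeta> \<eta> = \<zeta> (P \<eta>) - \<zeta> (N \<eta>)"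
  using r_P[of \<zeta> \<eta>] r_P[of \<eta> \<zeta>] r_N[of \<zeta> \<eta>] r_N[of \<eta> \<zeta>] assms by (simp_all add: flip_def)

lemma invariant_ast:
  assumes "\<zeta> \<in> D" "\<eta> \<in> D"
  shows "\<zeta> (x \<ast> P \<eta>) - \<zeta> (x \<ast> N \<eta>) = \<eta> (x \<star> N \<zeta>) - \<eta> (x \<star> P \<zeta>)"
proof -
  have "(tensor_map scale id (Lstar ast x) (r + \<tau> r) + tensor_map scale (Lop ast x) id (r + \<tau> r)) \<zeta> \<eta> = 0"
    using invariant by (simp add: invariant_tensor_def)
  then have "(r + \<tau> r) \<zeta> (\<eta> \<circ> Lstar ast x) + (r + \<tau> r) (\<zeta> \<circ> Lop ast x) \<eta> = 0"
    using assms by (simp add: tensor_map_def)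
  then show ?thesis
    unfolding symmetric_part(1)[OF assms(1) dual_comp(3)[OF assms(2)]]
      symmetric_part(2)[OF dual_comp(1)[OF assms(1)] assms(2)]
    by (simp add: op_lambda) algebra
qed

lemma invariant_circ:
  assumes "\<zeta> \<in> D" "\<eta> \<in> D"
  shows "\<zeta> (x \<odot> P \<eta>) - \<zeta> (x \<odot> N \<eta>) = \<eta> \<lbrakk>x, P \<zeta>\<rbrakk> - \<eta> \<lbrakk>x, N \<zeta>\<rbrakk>"
proof -
  have "(tensor_map scale (Lop circ x) id (r + \<tau> r) - tensor_map scale id (ad circ x) (r + \<tau> r)) \<zeta> \<eta> = 0"
    using invariant by (simp add: invariant_tensor_def)
  then have "(r + \<tau> r) (\<zeta> \<circ> Lop circ x) \<eta> - (r + \<tau> r) \<zeta> (\<eta> \<circ> ad circ x) = 0"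
    using assms by (simp add: tensor_map_def)
  then show ?thesis
    unfolding symmetric_part(1)[OF assms(1) dual_comp(6)[OF assms(2)]]
      symmetric_part(2)[OF dual_comp(4)[OF assms(1)] assms(2)]
    by (simp add: op_lambda)
qed

lemma Delta_PN:
  assumes "\<zeta> \<in> D" "\<eta> \<in> D"
  shows "\<Delta> x \<zeta> \<eta> = \<zeta> (x \<ast> N \<eta>) - \<eta> (x \<star> P \<zeta>)" "\<Delta> x \<zeta> \<eta> = \<zeta> (x \<ast> P \<eta>) - \<eta> (x \<star> N \<zeta>)"
proof -
  have "\<Delta> x \<zeta> \<eta> = - (r \<zeta> (\<eta> \<circ> Lstar ast x) + r (\<zeta> \<circ> Lop ast x) \<eta>)"
    using assms by (simp add: Delta_r_def tensor_map_def)
  then show *: "\<Delta> x \<zeta> \<eta> = \<zeta> (x \<ast> N \<eta>) - \<eta> (x \<star> P \<zeta>)"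
    unfolding r_P[OF assms(1) dual_comp(3)[OF assms(2)]] r_N[OF dual_comp(1)[OF assms(1)] assms(2)]
    by (simp add: op_lambda)
  show "\<Delta> x \<zeta> \<eta> = \<zeta> (x \<ast> P \<eta>) - \<eta> (x \<star> N \<zeta>)"
    unfolding * using invariant_ast[OF assms, of x] by (simp add: algebra_simps)
qed

lemma delta_PN:
  assumes "\<zeta> \<in> D" "\<eta> \<in> D"
  shows "\<delta> x \<zeta> \<eta> = - \<zeta> (x \<odot> N \<eta>) - \<eta> \<lbrakk>x, P \<zeta>\<rbrakk>" "\<delta> x \<zeta> \<eta> = - \<zeta> (x \<odot> P \<eta>) - \<eta> \<lbrakk>x, N \<zeta>\<rbrakk>"
proof -
  have "\<delta> x \<zeta> \<eta> = r (\<zeta> \<circ> Lop circ x) \<eta> - r \<zeta> (\<eta> \<circ> ad circ x)"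
    using assms by (simp add: delta_r_def tensor_map_def)
  then show *: "\<delta> x \<zeta> \<eta> = - \<zeta> (x \<odot> N \<eta>) - \<eta> \<lbrakk>x, P \<zeta>\<rbrakk>"
    unfolding r_P[OF assms(1) dual_comp(6)[OF assms(2)]] r_N[OF dual_comp(4)[OF assms(1)] assms(2)]
    by (simp add: op_lambda)
  show "\<delta> x \<zeta> \<eta> = - \<zeta> (x \<odot> P \<eta>) - \<eta> \<lbrakk>x, N \<zeta>\<rbrakk>"
    unfolding * using invariant_circ[OF assms, of x] by (simp add: algebra_simps)
qed

text \<open>Since \<open>P - N\<close> is self-adjoint, invariance says that it intertwines left multiplication by \<open>p\<close> on \<open>A\<close>
  with the negative transpose of \<open>p \<star> \<cdot>\<close> on the dual space.\<close>

lemma twist_ast: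
  assumes "\<theta> \<in> D"
  shows "P (\<lambda>u. \<theta> (- (u \<star> p))) - N (\<lambda>u. \<theta> (- (u \<star> p))) = p \<ast> P \<theta> - p \<ast> N \<theta>"
proof (rule dual_space_separates)
  let ?\<phi> = "\<lambda>u. \<theta> (- (u \<star> p))"
  have \<phi>: "?\<phi> \<in> D"
    by (rule dual_spaceI; simp add: op_simps functional_simps[OF assms])
  fix \<kappa> assume \<kappa>: "\<kappa> \<in> D"
  have "\<kappa> (P ?\<phi>) - \<kappa> (N ?\<phi>) = ?\<phi> (P \<kappa>) - ?\<phi> (N \<kappa>)"
    using symmetric_part[OF \<phi> \<kappa>] by simp
  then show "\<kappa> (P ?\<phi> - N ?\<phi>) = \<kappa> (p \<ast> P \<theta> - p \<ast> N \<theta>)"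
    using invariant_ast[OF \<kappa> assms, of p]
    by (simp add: functional_simps[OF assms] functional_simps[OF \<kappa>] star_commute[of p])
qed unfold_locales

lemma twist_circ:
  assumes "\<theta> \<in> D"
  shows "P (\<lambda>u. \<theta> (- \<lbrakk>u, p\<rbrakk>)) - N (\<lambda>u. \<theta> (- \<lbrakk>u, p\<rbrakk>)) = p \<odot> P \<theta> - p \<odot> N \<theta>"
proof (rule dual_space_separates)
  let ?\<phi> = "\<lambda>u. \<theta> (- \<lbrakk>u, p\<rbrakk>)"
  have \<phi>: "?\<phi> \<in> D"
    by (rule dual_spaceI; simp add: op_simps functional_simps[OF assms])
  fix \<kappa> assume \<kappa>: "\<kappa> \<in> D"
  have "\<kappa> (P ?\<phi>) - \<kappa> (N ?\<phi>) = ?\<phi> (P \<kappa>) - ?\<phi> (N \<kappa>)"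
    using symmetric_part[OF \<phi> \<kappa>] by simp
  then show "\<kappa> (P ?\<phi> - N ?\<phi>) = \<kappa> (p \<odot> P \<theta> - p \<odot> N \<theta>)"
    using invariant_circ[OF \<kappa> assms, of p]
    by (simp add: functional_simps[OF assms] functional_simps[OF \<kappa>] bracket_swap[of p])
qed unfold_locales

end

section \<open>Compatibility of the coproducts with the products\<close>

context invariant_pairing
begin

text \<open>Where \<open>r\<close> has an operator on each tensor factor, a pairing takes the form \<open>\<zeta> (x \<ast> N (\<eta> \<circ> h))\<close> or
  \<open>\<eta> (h (P (\<zeta> \<circ> Lop ast x)))\<close>, and similarly for the other operators. The first form is rewritten to the
  second, after which such terms cancel.\<close>

lemma adjoint_ops:
  assumes "\<zeta> \<in> D" "\<phi> \<in> D"
  shows "\<zeta> (x \<ast> N \<phi>) = - \<phi> (P (\<zeta> \<circ> Lop ast x))" "\<zeta> (N \<phi> \<ast> x) = - \<phi> (P (\<zeta> \<circ> Rop ast x))"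
    "\<zeta> (x \<odot> N \<phi>) = - \<phi> (P (\<zeta> \<circ> Lop circ x))" "\<zeta> (N \<phi> \<odot> x) = - \<phi> (P (\<zeta> \<circ> Rop circ x))"
  using adjoint[OF dual_comp(1)[OF assms(1)] assms(2)] adjoint[OF dual_comp(2)[OF assms(1)] assms(2)]
    adjoint[OF dual_comp(4)[OF assms(1)] assms(2)] adjoint[OF dual_comp(5)[OF assms(1)] assms(2)]
  by (simp_all add: op_apply)

text \<open>The form of the coproduct with \<open>P\<close> and \<open>N\<close> interchanged is used after a flip, so that \<open>\<zeta>\<close> always
  sees \<open>N \<eta>\<close> and \<open>\<eta>\<close> always sees \<open>P \<zeta>\<close>.\<close>

lemma flip_PN:
  assumes "\<zeta> \<in> D" "\<eta> \<in> D"
  shows "\<tau> (\<Delta> x) \<zeta> \<eta> = \<eta> (x \<ast> P \<zeta>) - \<zeta> (x \<star> N \<eta>)"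
    "\<tau> (\<delta> x) \<zeta> \<eta> = - \<eta> (x \<odot> P \<zeta>) - \<zeta> \<lbrakk>x, N \<eta>\<rbrakk>"
  using Delta_PN(2)[OF assms(2,1)] delta_PN(2)[OF assms(2,1)] by (simp_all add: flip_def)

lemma tensor_map_apply:
  "\<lbrakk>\<zeta> \<in> D; \<eta> \<in> D\<rbrakk> \<Longrightarrow> tensor_map scale f g t \<zeta> \<eta> = t (\<zeta> \<circ> f) (\<eta> \<circ> g)"
  by (simp add: tensor_map_def)

lemmas pairing_simps = tensor_map_apply flip_simps Delta_PN(1) delta_PN(1) flip_PN dual_comp
  adjoint_ops[OF _ dual_comp(1)] adjoint_ops[OF _ dual_comp(2)] adjoint_ops[OF _ dual_comp(3)]
  adjoint_ops[OF _ dual_comp(4)] adjoint_ops[OF _ dual_comp(5)] adjoint_ops[OF _ dual_comp(6)]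
  op_apply op_simps anticomm_def commut_def

lemma tensor_eqI:
  fixes s t :: "('k, 'v) tensor2"
  assumes "\<And>\<zeta> \<eta>. \<lbrakk>\<zeta> \<in> D; \<eta> \<in> D\<rbrakk> \<Longrightarrow> s \<zeta> \<eta> = t \<zeta> \<eta>"
    and "\<And>\<zeta> \<eta>. \<zeta> \<notin> D \<or> \<eta> \<notin> D \<Longrightarrow> s \<zeta> \<eta> = t \<zeta> \<eta>"
  shows "s = t"
  using assms by blast

lemmas off_dual = Delta_r_def delta_r_def tensor_map_def flip_def

text \<open>Each compatibility condition is paired with \<open>\<zeta> \<otimes> \<eta>\<close>. The terms under \<open>\<zeta>\<close> then form an identity of
  \<open>A\<close> in \<open>x\<close>, \<open>y\<close>, \<open>N \<eta>\<close> and those under \<open>\<eta>\<close> one in \<open>x\<close>, \<open>y\<close>, \<open>P \<zeta>\<close>; these are the two equations that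
  each proof cites.\<close>

lemma Delta_star:
  "\<Delta> (anticomm ast x y) =
        tensor_map scale id (Lstar ast x) (\<Delta> y) - tensor_map scale (Lop ast y) id (\<Delta> x)"
  (is "?s = ?t")
proof (rule tensor_eqI)
  fix \<zeta> \<eta> assume D: "\<zeta> \<in> D" "\<eta> \<in> D"
  show "?s \<zeta> \<eta> = ?t \<zeta> \<eta>"
    by (rule eq_by_two_equations[OF star_ast[of y x "N \<eta>"] star_assoc[of x y "P \<zeta>", symmetric],
        where \<zeta> = \<zeta> and \<eta> = \<eta>])
      (simp add: pairing_simps functional_simps[OF D(1)] functional_simps[OF D(2)] D algebra_simps)
qed (auto simp: off_dual)

lemma Delta_ast_symmetrized:
  "\<Delta> (x \<ast> y) + \<tau> (\<Delta> (x \<ast> y)) =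
        tensor_map scale (Lop ast x) id (\<Delta> y + \<tau> (\<Delta> y)) - tensor_map scale id (Rop ast y) (\<Delta> x)"
  (is "?s = ?t")
proof (rule tensor_eqI)
  fix \<zeta> \<eta> assume D: "\<zeta> \<in> D" "\<eta> \<in> D"
  show "?s \<zeta> \<eta> = ?t \<zeta> \<eta>"
    by (rule eq_by_two_equations[OF ast_left_commute[of x "N \<eta>" y] star_ast[of "P \<zeta>" x y, symmetric],
        where \<zeta> = \<zeta> and \<eta> = \<eta>])
      (simp add: pairing_simps functional_simps[OF D(1)] functional_simps[OF D(2)] D algebra_simps)
qed (auto simp: off_dual)

lemma delta_bracket:
  "\<delta> (commut circ x y) =
        (tensor_map scale id (ad circ x) (\<delta> y) - tensor_map scale (Lop circ x) id (\<delta> y))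
        - (tensor_map scale id (ad circ y) (\<delta> x) - tensor_map scale (Lop circ y) id (\<delta> x))"
  (is "?s = ?t")
proof (rule tensor_eqI)
  fix \<zeta> \<eta> assume D: "\<zeta> \<in> D" "\<eta> \<in> D"
  show "?s \<zeta> \<eta> = ?t \<zeta> \<eta>"
    by (rule eq_by_two_equations[OF circ_circ[of x y "N \<eta>", symmetric] jacobi[of x y "P \<zeta>"],
        where \<zeta> = \<zeta> and \<eta> = \<eta>])
      (simp add: pairing_simps functional_simps[OF D(1)] functional_simps[OF D(2)] D algebra_simps)
qed (auto simp: off_dual)

lemma delta_circ_skew:
  "(\<lambda>t. t - \<tau> t)
        (\<delta> (x \<odot> y) - tensor_map scale (Lop circ x) id (\<delta> y)
         - tensor_map scale id (Lop circ x) (\<delta> y) + tensor_map scale id (Rop circ y) (\<delta> x)) = 0"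
  (is "?s = ?t")
proof (rule tensor_eqI)
  fix \<zeta> \<eta> assume D: "\<zeta> \<in> D" "\<eta> \<in> D"
  show "?s \<zeta> \<eta> = ?t \<zeta> \<eta>"
    by (rule eq_by_two_equations[OF circ_circ[of x "N \<eta>" y] circ_circ[of x "P \<zeta>" y, symmetric],
        where \<zeta> = \<zeta> and \<eta> = \<eta>])
      (simp add: pairing_simps functional_simps[OF D(1)] functional_simps[OF D(2)] D algebra_simps)
qed (auto simp: off_dual)

lemma delta_star:
  "\<delta> (anticomm ast x y) =
        tensor_map scale id (Lstar ast x) (\<delta> y) + tensor_map scale id (Lstar ast y) (\<delta> x)
        + tensor_map scale (Lop circ x) id (\<Delta> y) + tensor_map scale (Lop circ y) id (\<Delta> x)"
  (is "?s = ?t")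
proof (rule tensor_eqI)
  fix \<zeta> \<eta> assume D: "\<zeta> \<in> D" "\<eta> \<in> D"
  show "?s \<zeta> \<eta> = ?t \<zeta> \<eta>"
    by (rule eq_by_two_equations[OF circ_ast_symmetrized[of x y "N \<eta>", symmetric] leibniz[of "P \<zeta>" x y],
        where \<zeta> = \<zeta> and \<eta> = \<eta>])
      (simp add: pairing_simps functional_simps[OF D(1)] functional_simps[OF D(2)] D algebra_simps)
qed (auto simp: off_dual)

lemma Delta_bracket:
  "\<Delta> (commut circ x y) =
        - tensor_map scale (Lop circ x) id (\<Delta> y) - tensor_map scale id (Lstar ast y) (\<delta> x)
        - tensor_map scale (Lop ast y) id (\<delta> x) + tensor_map scale id (ad circ x) (\<Delta> y)"
  (is "?s = ?t")
proof (rule tensor_eqI)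
  fix \<zeta> \<eta> assume D: "\<zeta> \<in> D" "\<eta> \<in> D"
  show "?s \<zeta> \<eta> = ?t \<zeta> \<eta>"
    by (rule eq_by_two_equations[OF bracket_ast[of x y "N \<eta>"] leibniz[of x y "P \<zeta>"],
        where \<zeta> = \<zeta> and \<eta> = \<eta>])
      (simp add: pairing_simps functional_simps[OF D(1)] functional_simps[OF D(2)] D algebra_simps)
qed (auto simp: off_dual)

lemma Delta_circ_symmetrized:
  "\<Delta> (x \<odot> y) + \<tau> (\<Delta> (x \<odot> y)) = (\<lambda>t. t + \<tau> t)
        (tensor_map scale (Lop circ x) id (\<Delta> y) + tensor_map scale id (Lop circ x) (\<Delta> y)
         + tensor_map scale id (Rop ast y) (\<delta> x))"
  (is "?s = ?t")
proof (rule tensor_eqI)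
  fix \<zeta> \<eta> assume D: "\<zeta> \<in> D" "\<eta> \<in> D"
  show "?s \<zeta> \<eta> = ?t \<zeta> \<eta>"
    by (rule eq_by_two_equations[OF bracket_ast[of x "N \<eta>" y] bracket_ast[of x "P \<zeta>" y],
        where \<zeta> = \<zeta> and \<eta> = \<eta>])
      (simp add: pairing_simps functional_simps[OF D(1)] functional_simps[OF D(2)] D algebra_simps)
qed (auto simp: off_dual)

lemma delta_ast_skew:
  "\<delta> (x \<ast> y) - \<tau> (\<delta> (x \<ast> y)) =
        tensor_map scale id (Lop ast x) (\<delta> y) - \<tau> (tensor_map scale (Lop ast x) id (\<delta> y))
        - tensor_map scale (Lop circ x) id (\<Delta> y) - \<tau> (tensor_map scale id (Lop circ x) (\<Delta> y))
        - tensor_map scale id (Rop ast y) (\<delta> x) - \<tau> (tensor_map scale id (Rop circ y) (\<Delta> x))"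
  (is "?s = ?t")
proof (rule tensor_eqI)
  fix \<zeta> \<eta> assume D: "\<zeta> \<in> D" "\<eta> \<in> D"
  show "?s \<zeta> \<eta> = ?t \<zeta> \<eta>"
    by (rule eq_by_two_equations[OF circ_ast_symmetrized[of x "N \<eta>" y, symmetric] bracket_ast[of "P \<zeta>" x y],
        where \<zeta> = \<zeta> and \<eta> = \<eta>])
      (simp add: pairing_simps functional_simps[OF D(1)] functional_simps[OF D(2)] D algebra_simps)
qed (auto simp: off_dual)

section \<open>The coproducts as linear maps\<close>

lemma Delta_tensor: "\<Delta> x \<in> tensor_space scale"
  unfolding Delta_r_def
  by (intro tensor_space_minus tensor_space_plus tensor_space_tensor_map r_tensor) (simp_all add: dual_comp)

lemma delta_tensor: "\<delta> x \<in> tensor_space scale"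
proof -
  have "\<delta> x = tensor_map scale (Lop circ x) id r + - tensor_map scale id (ad circ x) r"
    by (simp add: delta_r_def)
  also have "\<dots> \<in> tensor_space scale"
    by (intro tensor_space_minus tensor_space_plus tensor_space_tensor_map r_tensor) (simp_all add: dual_comp)
  finally show ?thesis .
qed

lemma Delta_linear: "Vector_Spaces.linear scale tensor_scale \<Delta>"
  by (rule linear_tensorI[OF Delta_tensor], rule dual_spaceI)
    (simp_all add: Delta_PN(1) op_simps functional_simps algebra_simps)

lemma delta_linear: "Vector_Spaces.linear scale tensor_scale \<delta>"
  by (rule linear_tensorI[OF delta_tensor], rule dual_spaceI)
    (simp_all add: delta_PN(1) op_simps functional_simps algebra_simps)

end

section \<open>Contractions as homomorphisms\<close>

text \<open>The two assumptions are the components \<open>D(r) = 0\<close> and \<open>S(r) = 0\<close> of the APP-YBE, paired with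
  \<open>\<zeta> \<otimes> \<eta> \<otimes> \<theta>\<close>; the sign of \<open>N\<close> accounts for the signs that differ.\<close>

locale app_ybe_pairing = invariant_pairing +
  assumes ybe_ast: "\<lbrakk>\<zeta> \<in> D; \<eta> \<in> D; \<theta> \<in> D\<rbrakk> \<Longrightarrow> \<zeta> (N \<eta> \<ast> N \<theta>) + \<eta> (P \<zeta> \<ast> N \<theta>) = \<theta> (P \<zeta> \<star> P \<eta>)"
    and ybe_circ: "\<lbrakk>\<zeta> \<in> D; \<eta> \<in> D; \<theta> \<in> D\<rbrakk> \<Longrightarrow> \<zeta> (N \<eta> \<odot> N \<theta>) = \<eta> (P \<zeta> \<odot> N \<theta>) + \<theta> \<lbrakk>P \<zeta>, P \<eta>\<rbrakk>"
begin

abbreviation dual_ast (infixl \<open>\<ast>\<^sub>r\<close> 70) where "\<zeta> \<ast>\<^sub>r \<eta> \<equiv> dual_op \<Delta> \<zeta> \<eta>"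
abbreviation dual_circ (infixl \<open>\<odot>\<^sub>r\<close> 70) where "\<zeta> \<odot>\<^sub>r \<eta> \<equiv> dual_op \<delta> \<zeta> \<eta>"

lemma range_tensor: "range \<Delta> \<subseteq> tensor_space scale" "range \<delta> \<subseteq> tensor_space scale"
  by (auto simp: Delta_tensor delta_tensor)

lemmas dual_ast_closed = dual_op_bilinear(1)[OF Delta_linear range_tensor(1)]
  and dual_circ_closed = dual_op_bilinear(1)[OF delta_linear range_tensor(2)]

text \<open>For \<open>N\<close> the homomorphism property is the APP-YBE itself, read with the first functional as test
  functional.\<close>

lemma N_ast: "\<lbrakk>\<zeta> \<in> D; \<eta> \<in> D\<rbrakk> \<Longrightarrow> N (\<zeta> \<ast>\<^sub>r \<eta>) = N \<zeta> \<ast> N \<eta>"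
proof (rule dual_space_separates)
  fix \<kappa> assume D: "\<zeta> \<in> D" "\<eta> \<in> D" "\<kappa> \<in> D"
  have "\<kappa> (N (\<zeta> \<ast>\<^sub>r \<eta>)) = - \<Delta> (P \<kappa>) \<zeta> \<eta>"
    using adjoint[OF D(3) dual_ast_closed[OF D(1,2)]] by (simp add: dual_op_def)
  also have "\<dots> = \<eta> (P \<kappa> \<star> P \<zeta>) - \<zeta> (P \<kappa> \<ast> N \<eta>)"
    using D by (simp add: Delta_PN(1))
  also have "\<dots> = \<kappa> (N \<zeta> \<ast> N \<eta>)"
    using ybe_ast[OF D(3,1,2)] by (simp add: diff_eq_eq)
  finally show "\<kappa> (N (\<zeta> \<ast>\<^sub>r \<eta>)) = \<kappa> (N \<zeta> \<ast> N \<eta>)" .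
qed unfold_locales

text \<open>Here the test functional belongs in the last place of the pairing, where the APP-YBE only produces
  \<open>P \<zeta> \<star> P \<eta>\<close>. Invariance therefore replaces \<open>P \<zeta> \<ast> P \<eta>\<close> by \<open>P \<zeta> \<ast> N \<eta>\<close>, which the APP-YBE with
  \<open>\<eta>\<close> in the last place controls.\<close>

lemma P_ast: "\<lbrakk>\<zeta> \<in> D; \<eta> \<in> D\<rbrakk> \<Longrightarrow> P (\<zeta> \<ast>\<^sub>r \<eta>) = P \<zeta> \<ast> P \<eta>"
proof (rule dual_space_separates)
  fix \<kappa> assume D: "\<zeta> \<in> D" "\<eta> \<in> D" "\<kappa> \<in> D"
  have "\<kappa> (P (\<zeta> \<ast>\<^sub>r \<eta>)) = - \<Delta> (N \<kappa>) \<zeta> \<eta>"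
    using adjoint[OF dual_ast_closed[OF D(1,2)] D(3)] by (simp add: dual_op_def)
  also have "\<dots> = \<eta> (P \<zeta> \<star> N \<kappa>) - \<zeta> (N \<kappa> \<ast> N \<eta>)"
    using D by (simp add: Delta_PN(1) star_commute)
  also have "\<dots> = \<kappa> (P \<zeta> \<ast> P \<eta>)"
    using invariant_ast[OF D(3,2), of "P \<zeta>"]
    unfolding ybe_ast[OF D(1,3,2), symmetric] by (simp add: algebra_simps)
  finally show "\<kappa> (P (\<zeta> \<ast>\<^sub>r \<eta>)) = \<kappa> (P \<zeta> \<ast> P \<eta>)" .
qed unfold_locales

lemma N_circ: "\<lbrakk>\<zeta> \<in> D; \<eta> \<in> D\<rbrakk> \<Longrightarrow> N (\<zeta> \<odot>\<^sub>r \<eta>) = N \<zeta> \<odot> N \<eta>"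
proof (rule dual_space_separates)
  fix \<kappa> assume D: "\<zeta> \<in> D" "\<eta> \<in> D" "\<kappa> \<in> D"
  have "\<kappa> (N (\<zeta> \<odot>\<^sub>r \<eta>)) = - \<delta> (P \<kappa>) \<zeta> \<eta>"
    using adjoint[OF D(3) dual_circ_closed[OF D(1,2)]] by (simp add: dual_op_def)
  then show "\<kappa> (N (\<zeta> \<odot>\<^sub>r \<eta>)) = \<kappa> (N \<zeta> \<odot> N \<eta>)"
    using ybe_circ[OF D(3,1,2)] D by (simp add: delta_PN(1) algebra_simps)
qed unfold_locales

lemma P_circ: "\<lbrakk>\<zeta> \<in> D; \<eta> \<in> D\<rbrakk> \<Longrightarrow> P (\<zeta> \<odot>\<^sub>r \<eta>) = P \<zeta> \<odot> P \<eta>"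
proof (rule dual_space_separates)
  fix \<kappa> assume D: "\<zeta> \<in> D" "\<eta> \<in> D" "\<kappa> \<in> D"
  have "\<kappa> (P (\<zeta> \<odot>\<^sub>r \<eta>)) = - \<delta> (N \<kappa>) \<zeta> \<eta>"
    using adjoint[OF dual_circ_closed[OF D(1,2)] D(3)] by (simp add: dual_op_def)
  also have "\<dots> = \<zeta> (N \<kappa> \<odot> N \<eta>) - \<eta> \<lbrakk>P \<zeta>, N \<kappa>\<rbrakk>"
    using D by (simp add: delta_PN(1) bracket_swap[of "N \<kappa>"] functional_simps[OF D(2)])
  also have "\<dots> = \<kappa> (P \<zeta> \<odot> P \<eta>)"
    using invariant_circ[OF D(3,2), of "P \<zeta>"]
    unfolding ybe_circ[OF D(1,3,2)] by (simp add: algebra_simps)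
  finally show "\<kappa> (P (\<zeta> \<odot>\<^sub>r \<eta>)) = \<kappa> (P \<zeta> \<odot> P \<eta>)" .
qed unfold_locales

sublocale ast_product: coadjoint_product scale P N "(\<ast>)" "(\<ast>)" "\<lambda>x y. - (x \<star> y)" "dual_op \<Delta>"
proof (unfold_locales, goal_cases)
  case (1 \<alpha> \<beta> w)
  then show ?case by (simp add: dual_op_def Delta_PN(1) functional_simps[OF 1(1)] functional_simps[OF 1(2)])
next
  case (2 \<alpha> \<beta> w)
  then show ?case by (simp add: dual_op_def Delta_PN(2) functional_simps[OF 2(1)] functional_simps[OF 2(2)])
next
  case (3 \<alpha> \<beta>)
  then show ?case by (rule dual_ast_closed)
next
  case (4 \<alpha> \<beta>)
  then show ?case by (rule P_ast)
next
  case (5 \<alpha> \<beta>)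
  then show ?case by (rule N_ast)
next
  case (6 \<theta> p)
  show ?case by (rule dual_spaceI; simp add: op_simps functional_simps[OF 6])
next
  case (7 \<theta> p)
  then show ?case by (rule twist_ast)
qed (simp_all add: op_simps)

sublocale circ_product: coadjoint_product scale P N "(\<odot>)" "\<lambda>x y. - (x \<odot> y)" "\<lambda>x y. - \<lbrakk>x, y\<rbrakk>" "dual_op \<delta>"
proof (unfold_locales, goal_cases)
  case (1 \<alpha> \<beta> w)
  then show ?case by (simp add: dual_op_def delta_PN(1) functional_simps[OF 1(1)] functional_simps[OF 1(2)])
next
  case (2 \<alpha> \<beta> w)
  then show ?case by (simp add: dual_op_def delta_PN(2) functional_simps[OF 2(1)] functional_simps[OF 2(2)])
next
  case (3 \<alpha> \<beta>)
  then show ?case by (rule dual_circ_closed)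
next
  case (4 \<alpha> \<beta>)
  then show ?case by (rule P_circ)
next
  case (5 \<alpha> \<beta>)
  then show ?case by (rule N_circ)
next
  case (6 \<theta> p)
  show ?case by (rule dual_spaceI; simp add: op_simps functional_simps[OF 6])
next
  case (7 \<theta> p)
  then show ?case by (rule twist_circ)
qed (simp_all add: op_simps)

sublocale ast_ast: coadjoint_product_pair scale P N "(\<ast>)" "(\<ast>)" "\<lambda>x y. - (x \<star> y)" "dual_op \<Delta>"
  "(\<ast>)" "(\<ast>)" "\<lambda>x y. - (x \<star> y)" "dual_op \<Delta>" ..
sublocale ast_circ: coadjoint_product_pair scale P N "(\<ast>)" "(\<ast>)" "\<lambda>x y. - (x \<star> y)" "dual_op \<Delta>"
  "(\<odot>)" "\<lambda>x y. - (x \<odot> y)" "\<lambda>x y. - \<lbrakk>x, y\<rbrakk>" "dual_op \<delta>" ..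
sublocale circ_ast: coadjoint_product_pair scale P N "(\<odot>)" "\<lambda>x y. - (x \<odot> y)" "\<lambda>x y. - \<lbrakk>x, y\<rbrakk>" "dual_op \<delta>"
  "(\<ast>)" "(\<ast>)" "\<lambda>x y. - (x \<star> y)" "dual_op \<Delta>" ..
sublocale circ_circ: coadjoint_product_pair scale P N "(\<odot>)" "\<lambda>x y. - (x \<odot> y)" "\<lambda>x y. - \<lbrakk>x, y\<rbrakk>" "dual_op \<delta>"
  "(\<odot>)" "\<lambda>x y. - (x \<odot> y)" "\<lambda>x y. - \<lbrakk>x, y\<rbrakk>" "dual_op \<delta>" ..

section \<open>The algebra structure on the dual space\<close>

lemma dual_product_split:
  assumes "\<zeta> \<in> D" "\<eta> \<in> D" "\<theta> \<in> D"
  shows "((\<zeta> + \<eta>) \<ast>\<^sub>r \<theta>) w = (\<zeta> \<ast>\<^sub>r \<theta>) w + (\<eta> \<ast>\<^sub>r \<theta>) w" "((\<zeta> - \<eta>) \<ast>\<^sub>r \<theta>) w = (\<zeta> \<ast>\<^sub>r \<theta>) w - (\<eta> \<ast>\<^sub>r \<theta>) w"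
    "((\<zeta> + \<eta>) \<odot>\<^sub>r \<theta>) w = (\<zeta> \<odot>\<^sub>r \<theta>) w + (\<eta> \<odot>\<^sub>r \<theta>) w" "((\<zeta> - \<eta>) \<odot>\<^sub>r \<theta>) w = (\<zeta> \<odot>\<^sub>r \<theta>) w - (\<eta> \<odot>\<^sub>r \<theta>) w"
    "(\<theta> \<odot>\<^sub>r (\<zeta> + \<eta>)) w = (\<theta> \<odot>\<^sub>r \<zeta>) w + (\<theta> \<odot>\<^sub>r \<eta>) w"
  by (simp_all add: dual_op_def tensor_space_simps[OF Delta_tensor assms] tensor_space_simps[OF delta_tensor assms])

lemmas left_triples = ast_ast.left_triple ast_circ.left_triple circ_ast.left_triple circ_circ.left_triple
lemmas right_triples = ast_ast.right_triple ast_circ.right_triple circ_ast.right_triple circ_circ.right_triple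

context
  fixes x y z
  assumes x: "x \<in> D" and y: "y \<in> D" and z: "z \<in> D"
begin

text \<open>The axioms are checked for the order \<open>x < y < z\<close>, expressed by the ranks 0, 1 and 2.
  Thus \<open>x\<close> sees \<open>N y\<close> and \<open>N z\<close>, \<open>y\<close> sees \<open>P x\<close> and \<open>N z\<close>, and \<open>z\<close> sees \<open>P x\<close> and \<open>P y\<close>. The three
  equations cited for each axiom are the identities of \<open>A\<close> found under \<open>x\<close>, \<open>y\<close> and \<open>z\<close>.\<close>

lemmas ordered_triples =
  left_triples[OF _ x y z, of 0 1 2] left_triples[OF _ y x z, of 1 0 2] left_triples[OF _ y z x, of 1 2 0]
  left_triples[OF _ z y x, of 2 1 0] left_triples[OF _ x z y, of 0 2 1] left_triples[OF _ z x y, of 2 0 1]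
  right_triples[OF _ x y z, of 0 1 2] right_triples[OF _ y x z, of 1 0 2] right_triples[OF _ y z x, of 1 2 0]
  right_triples[OF _ z y x, of 2 1 0] right_triples[OF _ x z y, of 0 2 1] right_triples[OF _ z x y, of 2 0 1]

lemmas expand = dual_product_split dual_ast_closed dual_circ_closed x y z ordered_triples letter_def
  functional_simps[OF x] functional_simps[OF y] functional_simps[OF z] op_simps
  anticomm_def commut_def

lemma dual_ast_ast: "x \<ast>\<^sub>r (y \<ast>\<^sub>r z) = - ((x \<ast>\<^sub>r y + y \<ast>\<^sub>r x) \<ast>\<^sub>r z)"
proof
  fix w
  show "(x \<ast>\<^sub>r (y \<ast>\<^sub>r z)) w =
    (- ((x \<ast>\<^sub>r y + y \<ast>\<^sub>r x) \<ast>\<^sub>r z)) w"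
    by (rule eq_by_three_equations[OF ast_left_commute[of w "N y" "N z"]
        star_ast[of "P x" w "N z", symmetric] star_assoc[of w "P x" "P y"],
        where \<zeta> = x and \<eta> = y and \<theta> = z])
      (simp add: expand algebra_simps)
qed

lemma dual_star_ast_commute: "- ((x \<ast>\<^sub>r y + y \<ast>\<^sub>r x) \<ast>\<^sub>r z) = - ((z \<ast>\<^sub>r y + y \<ast>\<^sub>r z) \<ast>\<^sub>r x)"
proof
  fix w
  show "(- ((x \<ast>\<^sub>r y + y \<ast>\<^sub>r x) \<ast>\<^sub>r z)) w =
    (- ((z \<ast>\<^sub>r y + y \<ast>\<^sub>r z) \<ast>\<^sub>r x)) w"
    by (rule eq_by_three_equations[OF star_star_ast[of w "N z" "N y", symmetric]
        ast_ast_reverse[of "P x" w "N z"] star_star_ast[of w "P x" "P y"],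
        where \<zeta> = x and \<eta> = y and \<theta> = z])
      (simp add: expand algebra_simps)
qed

lemma dual_circ_circ: "x \<odot>\<^sub>r (y \<odot>\<^sub>r z) - y \<odot>\<^sub>r (x \<odot>\<^sub>r z) = commut (\<odot>\<^sub>r) y x \<odot>\<^sub>r z"
proof
  fix w
  show "(x \<odot>\<^sub>r (y \<odot>\<^sub>r z) - y \<odot>\<^sub>r (x \<odot>\<^sub>r z)) w =
    (commut (\<odot>\<^sub>r) y x \<odot>\<^sub>r z) w"
    by (rule eq_by_three_equations[OF circ_circ[of w "N y" "N z", symmetric]
        circ_circ[of w "P x" "N z"] jacobi[of w "P y" "P x"],
        where \<zeta> = x and \<eta> = y and \<theta> = z])
      (simp add: expand algebra_simps)
qed

lemma dual_bracket_circ_cyclic: "commut (\<odot>\<^sub>r) x y \<odot>\<^sub>r z + commut (\<odot>\<^sub>r) y z \<odot>\<^sub>r x + commut (\<odot>\<^sub>r) z x \<odot>\<^sub>r y = 0"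
proof
  fix w
  show "(commut (\<odot>\<^sub>r) x y \<odot>\<^sub>r z + commut (\<odot>\<^sub>r) y z \<odot>\<^sub>r x + commut (\<odot>\<^sub>r) z x \<odot>\<^sub>r y) w = 0 w"
    by (rule eq_by_three_equations[OF bracket_bracket[of w "N y" "N z", symmetric]
        bracket_bracket[of w "N z" "P x", symmetric] bracket_bracket[of w "P x" "P y", symmetric],
        where \<zeta> = x and \<eta> = y and \<theta> = z])
      (simp add: expand algebra_simps)
qed

lemma dual_bracket_ast: "(x \<odot>\<^sub>r y - y \<odot>\<^sub>r x) \<ast>\<^sub>r z = y \<ast>\<^sub>r (x \<odot>\<^sub>r z) - x \<odot>\<^sub>r (y \<ast>\<^sub>r z)"
proof
  fix w
  show "((x \<odot>\<^sub>r y - y \<odot>\<^sub>r x) \<ast>\<^sub>r z) w =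
    (y \<ast>\<^sub>r (x \<odot>\<^sub>r z) - x \<odot>\<^sub>r (y \<ast>\<^sub>r z)) w"
    by (rule eq_by_three_equations[OF circ_ast_symmetrized[of w "N y" "N z", symmetric]
        bracket_ast[of "P x" w "N z"] leibniz[of "P x" w "P y"],
        where \<zeta> = x and \<eta> = y and \<theta> = z])
      (simp add: expand algebra_simps)
qed

lemma dual_star_circ: "(x \<ast>\<^sub>r y + y \<ast>\<^sub>r x) \<odot>\<^sub>r z = - (x \<ast>\<^sub>r (y \<odot>\<^sub>r z)) - y \<ast>\<^sub>r (x \<odot>\<^sub>r z)"
proof
  fix w
  show "((x \<ast>\<^sub>r y + y \<ast>\<^sub>r x) \<odot>\<^sub>r z) w =
    (- (x \<ast>\<^sub>r (y \<odot>\<^sub>r z)) - y \<ast>\<^sub>r (x \<odot>\<^sub>r z)) w"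
    by (rule eq_by_three_equations[OF star_circ[of w "N y" "N z"]
        star_circ[of w "P x" "N z"] bracket_star_cyclic[of w "P x" "P y", symmetric],
        where \<zeta> = x and \<eta> = y and \<theta> = z])
      (simp add: expand algebra_simps)
qed

lemma dual_circ_star: "z \<odot>\<^sub>r (x \<ast>\<^sub>r y + y \<ast>\<^sub>r x) + x \<ast>\<^sub>r (y \<odot>\<^sub>r z) + y \<ast>\<^sub>r (x \<odot>\<^sub>r z) = x \<ast>\<^sub>r (z \<odot>\<^sub>r y) + y \<ast>\<^sub>r (z \<odot>\<^sub>r x)"
proof
  fix w
  show "(z \<odot>\<^sub>r (x \<ast>\<^sub>r y + y \<ast>\<^sub>r x) + x \<ast>\<^sub>r (y \<odot>\<^sub>r z) + y \<ast>\<^sub>r (x \<odot>\<^sub>r z)) w =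
    (x \<ast>\<^sub>r (z \<odot>\<^sub>r y) + y \<ast>\<^sub>r (z \<odot>\<^sub>r x)) w"
    by (rule eq_by_three_equations[OF circ_star[of "N z" w "N y"]
        circ_star[of "N z" w "P x"] circ_star_cyclic[of w "P x" "P y", symmetric],
        where \<zeta> = x and \<eta> = y and \<theta> = z])
      (simp add: expand algebra_simps)
qed

end

lemma dual_algebra: "anti_pre_poisson_algebra dual_scale D (\<ast>\<^sub>r) (\<odot>\<^sub>r)"
proof -
  have fd: "fd_vector_space dual_scale D"
    by (rule fd_dual_space) unfold_locales
  have comm: "z \<ast>\<^sub>r (x \<ast>\<^sub>r y) = x \<ast>\<^sub>r (z \<ast>\<^sub>r y)" if "x \<in> D" "y \<in> D" "z \<in> D" for x y z
    using dual_ast_ast[OF that(3,1,2)] dual_ast_ast[OF that(1,3,2)] by (simp add: add.commute)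
  have "anti_zinbiel_algebra dual_scale D (\<ast>\<^sub>r)"
    using fd dual_op_bilinear(2)[OF Delta_linear range_tensor(1)] dual_ast_ast dual_star_ast_commute comm
    by (simp add: anti_zinbiel_algebra_def anti_zinbiel_algebra_axioms_def)
  moreover have "anti_pre_lie_algebra dual_scale D (\<odot>\<^sub>r)"
    using fd dual_op_bilinear(2)[OF delta_linear range_tensor(2)] dual_circ_circ dual_bracket_circ_cyclic
    by (simp add: anti_pre_lie_algebra_def anti_pre_lie_algebra_axioms_def)
  ultimately show ?thesis
    using dual_bracket_ast dual_star_circ dual_circ_star
    by (simp add: anti_pre_poisson_algebra_def anti_pre_poisson_algebra_axioms_def)
qed

theorem bialgebra: "anti_pre_poisson_bialgebra scale ast circ \<Delta> \<delta>"
proof -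
  have "anti_pre_poisson_coalgebra scale \<Delta> \<delta>"
    by (intro anti_pre_poisson_coalgebra.intro anti_pre_poisson_coalgebra_axioms.intro
        Delta_linear delta_linear range_tensor dual_algebra) unfold_locales
  then show ?thesis
    by (intro anti_pre_poisson_bialgebra.intro anti_pre_poisson_bialgebra_axioms.intro
        Delta_star Delta_ast_symmetrized delta_bracket delta_circ_skew delta_star Delta_bracket
        Delta_circ_symmetrized delta_ast_skew anti_pre_poisson_algebra_axioms)
qed

end

section \<open>Coboundary bialgebras\<close>

context app_algebra
begin

text \<open>The presentation of \<open>r\<close> gives \<open>P\<close> and \<open>N\<close> explicitly. Pairing the two tensors of the APP-YBE with
  \<open>\<zeta> \<otimes> \<eta> \<otimes> \<theta>\<close> yields double sums over \<open>i\<close> and \<open>j\<close>, which bilinearity folds into products of values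
  of \<open>P\<close> and \<open>N\<close>.\<close>

lemma coboundary_bialgebra:
  fixes n :: nat and a b :: "nat \<Rightarrow> 'v" and r :: "('k, 'v) tensor2"
  assumes r: "r = (\<Sum>i<n. tensor scale (a i) (b i))"
    and ybe: "app_ybe scale ast circ n a b"
    and inv: "invariant_tensor scale ast circ (r + \<tau> r)"
  shows "anti_pre_poisson_bialgebra scale ast circ (Delta_r scale ast r) (delta_r scale circ r)"
proof -
  let ?D = "dual_space scale"
  define P where "P \<zeta> = (\<Sum>i<n. scale (\<zeta> (a i)) (b i))" for \<zeta>
  define N where "N \<zeta> = - (\<Sum>i<n. scale (\<zeta> (b i)) (a i))" for \<zeta>
  note lin = functional_simps dual_space_sum
  have bilinear_sum: "\<xi> (m (\<Sum>i<n. scale (c i) (u i)) (\<Sum>j<n. scale (d j) (v j))) =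
      (\<Sum>i<n. \<Sum>j<n. c i * d j * \<xi> (m (u i) (v j)))"
    if "\<xi> \<in> ?D" and m: "bilinear_op_on scale UNIV m" for \<xi> m c d and u v :: "nat \<Rightarrow> 'v"
  proof -
    have left: "m (\<Sum>i<n. h i) y = (\<Sum>i<n. m (h i) y)" for h :: "nat \<Rightarrow> 'v" and y
      by (rule additive.sum) (unfold_locales, rule bilinear_op_onD[OF m])
    have right: "m y (\<Sum>i<n. h i) = (\<Sum>i<n. m y (h i))" for h :: "nat \<Rightarrow> 'v" and y
      by (rule additive.sum) (unfold_locales, rule bilinear_op_onD[OF m])
    show ?thesis
      unfolding left by (simp add: right bilinear_op_onD[OF m] lin[OF that(1)] sum_distrib_left mult_ac)
  qed
  have bil: "bilinear_op_on scale UNIV (anticomm (\<ast>))" "bilinear_op_on scale UNIV (commut (\<odot>))"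
    by (auto simp: bilinear_op_on_def op_simps)
  interpret invariant_pairing scale ast circ P N r
  proof
    show "r \<in> tensor_space scale"
      unfolding r
      by (induction n)
        (simp_all only: lessThan_0 sum.empty sum.lessThan_Suc tensor_space_zero tensor_space_plus tensor_in_tensor_space)
    show "r \<zeta> \<eta> = \<eta> (P \<zeta>)" "r \<zeta> \<eta> = - \<zeta> (N \<eta>)" if "\<zeta> \<in> ?D" "\<eta> \<in> ?D" for \<zeta> \<eta>
      using that by (simp_all add: r P_def N_def sum_fun_apply tensor_def mult.commute
          lin[OF that(1)] lin[OF that(2)])
  qed (rule inv)
  interpret app_ybe_pairing scale ast circ P N r
  proof
    fix \<zeta> \<eta> \<theta> assume D: "\<zeta> \<in> ?D" "\<eta> \<in> ?D" "\<theta> \<in> ?D"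
    note pair = bilinear_sum[OF D(1) bilinear_ast] bilinear_sum[OF D(2) bilinear_ast] bilinear_sum[OF D(3) bil(1)]
      bilinear_sum[OF D(1) bilinear_circ] bilinear_sum[OF D(2) bilinear_circ] bilinear_sum[OF D(3) bil(2)]
    note D_lin = lin[OF D(1)] lin[OF D(2)] lin[OF D(3)]
    have "(\<Sum>i<n. \<Sum>j<n. tensor3 scale (a i) (ast (b i) (a j)) (b j)
        - tensor3 scale (ast (a i) (a j)) (b i) (b j)
        + tensor3 scale (a i) (a j) (anticomm ast (b i) (b j))) \<zeta> \<eta> \<theta> = 0"
      using ybe by (simp add: app_ybe_def)
    then have "- \<eta> (P \<zeta> \<ast> N \<theta>) - \<zeta> (N \<eta> \<ast> N \<theta>) + \<theta> (P \<zeta> \<star> P \<eta>) = 0"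
      unfolding P_def N_def using D
      by (simp add: op_simps D_lin pair sum_fun_apply tensor3_def
          sum.distrib sum_subtractf mult_ac)
    then show "\<zeta> (N \<eta> \<ast> N \<theta>) + \<eta> (P \<zeta> \<ast> N \<theta>) = \<theta> (P \<zeta> \<star> P \<eta>)"
      by (simp add: algebra_simps)
    have "(\<Sum>i<n. \<Sum>j<n. tensor3 scale (circ (a i) (a j)) (b i) (b j)
        + tensor3 scale (a i) (circ (b i) (a j)) (b j)
        - tensor3 scale (a i) (a j) (commut circ (b i) (b j))) \<zeta> \<eta> \<theta> = 0"
      using ybe by (simp add: app_ybe_def)
    then have "\<zeta> (N \<eta> \<odot> N \<theta>) - \<eta> (P \<zeta> \<odot> N \<theta>) - \<theta> \<lbrakk>P \<zeta>, P \<eta>\<rbrakk> = 0"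
      unfolding P_def N_def using D
      by (simp add: op_simps D_lin pair sum_fun_apply tensor3_def
          sum.distrib sum_subtractf mult_ac)
    then show "\<zeta> (N \<eta> \<odot> N \<theta>) = \<eta> (P \<zeta> \<odot> N \<theta>) + \<theta> \<lbrakk>P \<zeta>, P \<eta>\<rbrakk>"
      by (simp add: algebra_simps)
  qed
  show ?thesis by (rule bialgebra)
qed

end

theorem theorem4p6:
  fixes scale :: "'k::field \<Rightarrow> 'v::ab_group_add \<Rightarrow> 'v"
    and ast circ :: "'v \<Rightarrow> 'v \<Rightarrow> 'v"
    and n :: nat and a b :: "nat \<Rightarrow> 'v"
    and r :: "('k, 'v) tensor2"
  assumes "anti_pre_poisson_algebra scale UNIV ast circ"
    and "r = (\<Sum>i<n. tensor scale (a i) (b i))"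
    and "app_ybe scale ast circ n a b"
    and "invariant_tensor scale ast circ (r + \<tau> r)"
  shows "anti_pre_poisson_bialgebra scale ast circ (Delta_r scale ast r) (delta_r scale circ r)"
proof -
  interpret app_algebra scale ast circ
    using assms(1) by (rule app_algebra.intro)
  show ?thesis
    by (rule coboundary_bialgebra[OF assms(2-4)])
qed

end
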